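(* Let $k\ge 1$, and let $E_k$ and $B_k$ be the integer matrices defined in the context. For all partitions $\lambda=(\lambda_1,\ldots,\lambda_k)$, $\mu=(\mu_1,\ldots,\mu_k)$, $\nu=(\nu_1,\ldots,\nu_k)$ with at most $k$ parts such that $|\lambda|+|\mu|=|\nu|$ and $\lambda,\mu\subseteq\nu$ (i.e. $\lambda_i\le\nu_i$ and $\mu_i\le\nu_i$ for all $i$), the Littlewood–Richardson coefficient satisfies $$c_{\lambda\mu}^{\nu}=\phi_{E_k}\!\left(B_k\begin{pmatrix}\lambda\\ \mu\\ \nu\end{pmatrix}\right).$$
   Context: $c_{\lambda\mu}^{\nu}$ denotes the Littlewood–Richardson coefficient, defined by $s_\lambda s_\mu=\sum_\nu c_{\lambda\mu}^{\nu}s_\nu$ for Schur functions (equivalently, the multiplicity of $V_\nu$ in $V_\lambda\otimes V_\mu$ for $GL_k(\mathbb{C})$); $|\lambda|=\sum_i\lambda_i$. For an integer $d\times n$ matrix $M$, the vector partition function is $\phi_M(b)=|\{x\in\mathbb{N}^n : Mx=b\}|$ for $b\in\mathbb{Z}^d$. Construction of $E_k,B_k$. A $k$-hive is an array $(a_{ij})$ indexed by $i,j\ge 0$, $i+j\le k$. Impose the boundary values $a_{00}=0$, $a_{0j}=\lambda_1+\cdots+\lambda_j$ ($1\le j\le k$), $a_{i0}=\nu_1+\cdots+\nu_i$ ($1\le i\le k$), $a_{m,k-m}=|\lambda|+\mu_1+\cdots+\mu_m$ ($1\le m\le k$). The hive inequalities are, for all $i,j\ge0$ with $i+j\le k-2$: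 $a_{i+1,j}+a_{i,j+1}\ge a_{ij}+a_{i+1,j+1}$, $a_{i+1,j}+a_{i+1,j+1}\ge a_{i+2,j}+a_{i,j+1}$, $a_{i,j+1}+a_{i+1,j+1}\ge a_{i+1,j}+a_{i,j+2}$; there are $n(k)=3\binom{k}{2}$ of them. The interior variables are $a_{ij}$ with $i,j\ge1$, $i+j\le k-1$ (there are $\binom{k-1}{2}$ of them). Substituting the boundary values, write the $m$-th inequality ($1\le m\le n(k)$, in some fixed order) as $\sum_{i,j} b_{m,ij}a_{ij}\le \sum_t c_{mt}\lambda_t+\sum_t d_{mt}\mu_t+\sum_t e_{mt}\nu_t$, with only interior variables on the left. Then $E_k$ is the $n(k)\times(\binom{k-1}{2}+n(k))$ matrix $\big(\,(b_{m,ij})\ \big|\ I_{n(k)}\,\big)$ (the identity block corresponding to slack variables $s_m$), and $B_k$ is the $n(k)\times 3k$ matrix $\big(\,(c_{mt})\ \big|\ (d_{mt})\ \big|\ (e_{mt})\,\big)$ acting on the column vector $(\lambda_1,\ldots,\lambda_k,\mu_1,\ldots,\mu_k,\nu_1,\ldots,\nu_k)^T$. *)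

theory Defs
  imports "HOL-Library.Poly_Mapping" "Jordan_Normal_Form.Matrix"
begin

(* A partition is a function on nat, weakly decreasing and eventually 0.  Parts are indexed
   from 0: the part written lambda_(i+1) in the usual notation is lam i. *)
definition is_partition :: "(nat \<Rightarrow> nat) \<Rightarrow> bool" where
  "is_partition lam \<longleftrightarrow> antimono lam \<and> finite {i. lam i \<noteq> 0}"

definition partition_size :: "(nat \<Rightarrow> nat) \<Rightarrow> nat" where
  "partition_size lam = (\<Sum>i | lam i \<noteq> 0. lam i)"

definition at_most_parts :: "nat \<Rightarrow> (nat \<Rightarrow> nat) \<Rightarrow> bool" where
  "at_most_parts k lam \<longleftrightarrow> (\<forall>i\<ge>k. lam i = 0)"

(* Formal power series over the integers in countably many variables x_0, x_1, ...,
   given by the coefficient of each monomial (an exponent vector of finite support). *)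
type_synonym mseries = "(nat \<Rightarrow>\<^sub>0 nat) \<Rightarrow> int"

definition mseries_mult :: "mseries \<Rightarrow> mseries \<Rightarrow> mseries" where
  "mseries_mult f g = (\<lambda>\<alpha>. \<Sum>(\<beta>, \<gamma>) | \<beta> + \<gamma> = \<alpha>. f \<beta> * g \<gamma>)"

definition diagram :: "(nat \<Rightarrow> nat) \<Rightarrow> (nat \<times> nat) set" where
  "diagram lam = {(i, j). j < lam i}"

(* Fillings take the value 0 outside the diagram, so that distinct functions are distinct
   tableaux; the entry t stands for the variable x_t. *)
definition semistandard :: "(nat \<Rightarrow> nat) \<Rightarrow> (nat \<times> nat \<Rightarrow> nat) set" where
  "semistandard lam = {T.
     (\<forall>c. c \<notin> diagram lam \<longrightarrow> T c = 0) \<and>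
     (\<forall>i j. (i, Suc j) \<in> diagram lam \<longrightarrow> T (i, j) \<le> T (i, Suc j)) \<and>
     (\<forall>i j. (Suc i, j) \<in> diagram lam \<longrightarrow> T (i, j) < T (Suc i, j))}"

definition schur :: "(nat \<Rightarrow> nat) \<Rightarrow> mseries" where
  "schur lam = (\<lambda>\<alpha>. int (card {T \<in> semistandard lam.
     \<forall>t. card {c \<in> diagram lam. T c = t} = Poly_Mapping.lookup \<alpha> t}))"

(* lr_expansion lam mu c: s_lam * s_mu is the finite sum of c nu * s_nu over partitions nu. *)
definition lr_expansion ::
    "(nat \<Rightarrow> nat) \<Rightarrow> (nat \<Rightarrow> nat) \<Rightarrow> ((nat \<Rightarrow> nat) \<Rightarrow> int) \<Rightarrow> bool" where
  "lr_expansion lam mu c \<longleftrightarrow>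
     (\<forall>nu. c nu \<noteq> 0 \<longrightarrow> is_partition nu) \<and>
     finite {nu. c nu \<noteq> 0} \<and>
     mseries_mult (schur lam) (schur mu) = (\<lambda>\<alpha>. \<Sum>nu | c nu \<noteq> 0. c nu * schur nu \<alpha>)"

definition lr_coeff :: "(nat \<Rightarrow> nat) \<Rightarrow> (nat \<Rightarrow> nat) \<Rightarrow> (nat \<Rightarrow> nat) \<Rightarrow> int" where
  "lr_coeff lam mu nu = (THE c. lr_expansion lam mu c) nu"

definition vector_partition :: "int mat \<Rightarrow> int vec \<Rightarrow> nat" where
  "vector_partition M b =
     card {x :: nat vec. x \<in> carrier_vec (dim_col M) \<and> M *\<^sub>v map_vec int x = b}"

(* A k-hive with boundary values substituted and interior entries given by a.  The corner
   (k, 0) lies on two sides; its value is taken to be nu_1 + ... + nu_k (which equals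
   |lambda| + |mu| whenever |lambda| + |mu| = |nu|).  Used only at indices i + j \<le> k. *)
definition hive ::
    "nat \<Rightarrow> (nat \<Rightarrow> int) \<Rightarrow> (nat \<Rightarrow> int) \<Rightarrow> (nat \<Rightarrow> int) \<Rightarrow> (nat \<times> nat \<Rightarrow> int) \<Rightarrow> nat \<times> nat \<Rightarrow> int"
  where
  "hive k lam mu nu a = (\<lambda>(i, j).
     if i = 0 then (\<Sum>t<j. lam t)
     else if j = 0 then (\<Sum>t<i. nu t)
     else if i + j = k then (\<Sum>t<k. lam t) + (\<Sum>t<i. mu t)
     else a (i, j))"

type_synonym rhombus = "((nat \<times> nat) \<times> (nat \<times> nat)) \<times> ((nat \<times> nat) \<times> (nat \<times> nat))"

(* ((p, q), (r, s)) stands for the inequality a p + a q \<ge> a r + a s.  The indices (i, j)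
   range over i + j \<le> k - 2. *)
definition hive_inequalities :: "nat \<Rightarrow> rhombus list" where
  "hive_inequalities k = concat [
     [(((i+1, j), (i, j+1)), ((i, j), (i+1, j+1))),
      (((i+1, j), (i+1, j+1)), ((i+2, j), (i, j+1))),
      (((i, j+1), (i+1, j+1)), ((i+1, j), (i, j+2)))].
     i \<leftarrow> [0..<k], j \<leftarrow> [0..<k - 1 - i]]"

(* The indices i, j \<ge> 1 with i + j \<le> k - 1. *)
definition interior :: "nat \<Rightarrow> (nat \<times> nat) list" where
  "interior k = [(i, j). i \<leftarrow> [1..<k], j \<leftarrow> [1..<k - i]]"

(* The linear form whose nonpositivity is the inequality. *)
definition rhombus_form :: "rhombus \<Rightarrow> (nat \<times> nat \<Rightarrow> int) \<Rightarrow> int" where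
  "rhombus_form = (\<lambda>((p, q), (r, s)) a. a r + a s - a p - a q)"

(* rhombus_form R (hive k lam mu nu a) is linear in (lam, mu, nu, a) jointly, so each
   coefficient is its value at the corresponding unit vector; coefficients of lam, mu, nu
   change sign when moved to the right-hand side. *)
definition unit_fun :: "'a \<Rightarrow> 'a \<Rightarrow> int" where
  "unit_fun s = (\<lambda>t. if t = s then 1 else 0)"

definition b_coeff :: "nat \<Rightarrow> rhombus \<Rightarrow> nat \<times> nat \<Rightarrow> int" where
  "b_coeff k R v = rhombus_form R (hive k (\<lambda>_. 0) (\<lambda>_. 0) (\<lambda>_. 0) (unit_fun v))"

definition c_coeff :: "nat \<Rightarrow> rhombus \<Rightarrow> nat \<Rightarrow> int" where
  "c_coeff k R t = - rhombus_form R (hive k (unit_fun t) (\<lambda>_. 0) (\<lambda>_. 0) (\<lambda>_. 0))"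

definition d_coeff :: "nat \<Rightarrow> rhombus \<Rightarrow> nat \<Rightarrow> int" where
  "d_coeff k R t = - rhombus_form R (hive k (\<lambda>_. 0) (unit_fun t) (\<lambda>_. 0) (\<lambda>_. 0))"

definition e_coeff :: "nat \<Rightarrow> rhombus \<Rightarrow> nat \<Rightarrow> int" where
  "e_coeff k R t = - rhombus_form R (hive k (\<lambda>_. 0) (\<lambda>_. 0) (unit_fun t) (\<lambda>_. 0))"

definition append_cols :: "int mat \<Rightarrow> int mat \<Rightarrow> int mat" where
  "append_cols A B = four_block_mat A B (0\<^sub>m 0 (dim_col A)) (0\<^sub>m 0 (dim_col B))"

definition E_mat :: "nat \<Rightarrow> int mat" where
  "E_mat k = (let R = hive_inequalities k; V = interior k; n = length R in
     append_cols (mat n (length V) (\<lambda>(m, l). b_coeff k (R ! m) (V ! l))) (1\<^sub>m n))"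

definition B_mat :: "nat \<Rightarrow> int mat" where
  "B_mat k = (let R = hive_inequalities k; n = length R in
     append_cols (mat n k (\<lambda>(m, t). c_coeff k (R ! m) t))
       (append_cols (mat n k (\<lambda>(m, t). d_coeff k (R ! m) t))
          (mat n k (\<lambda>(m, t). e_coeff k (R ! m) t))))"

definition part_vec :: "nat \<Rightarrow> (nat \<Rightarrow> nat) \<Rightarrow> int vec" where
  "part_vec k lam = vec k (\<lambda>t. int (lam t))"

end

theory Submission
  imports Defs "HOL-Combinatorics.Permutations"
begin

text \<open>The successive differences along the rows of a hive form a Gelfand-Tsetlin pattern
  of shape \<open>\<lambda>\<close>: two of the three families of rhombus inequalities
  are the interlacing conditions, the boundary prescribes the weight \<open>\<nu> - \<mu>\<close>, and the
  third family says that \<open>\<mu>\<close> plus the weight of every initial set of columns is a partition.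
  That these patterns count \<open>c\<close> is Stembridge's proof of the Littlewood-Richardson rule:
  expand the product of the alternant of \<open>\<mu> + \<rho>\<close> with the Schur polynomial of
  \<open>\<lambda>\<close> over all patterns and cancel those violating the last condition by a
  sign-reversing involution. The involution is a piecewise linear reflection (toggle) of one row,
  applied to the columns after the first violation. The case \<open>\<mu> = 0\<close> is the bialternant
  formula, which converts alternants into Schur polynomials and gives their independence.\<close>

section \<open>Gelfand-Tsetlin patterns and their toggles\<close>

text \<open>The dominance condition is needed in two forms. The cancellation must find a first bad
  column of the tableau, which means a threshold \<open>J\<close> on the values of a pattern; a hive
  speaks of positions \<open>j\<close> in a row. For fixed rows the slack of the condition is
  concave in \<open>J\<close> between consecutive entries of the middle row \<open>i + 1\<close>, so
  testing \<open>J\<close> at these entries suffices, and each such test is one inequality per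
  position. A second obstacle: Schur functions have infinitely many variables, alternants a fixed
  number \<open>n\<close>. Coefficients are therefore read off for large \<open>n\<close>, and the
  count of patterns must be independent of \<open>n\<close>. It is, because the weight \<nu> - \<mu>
  vanishes beyond the length of \<nu>, which forces all later rows to be zero. Rows are numbered
  downwards from the full shape, as in a hive, so row \<open>i\<close> stands for the letter
  \<open>n - 1 - i\<close>; the symmetry of Schur polynomials absorbs this reversal of the
  alphabet.\<close>

definition gt_patterns :: "nat \<Rightarrow> (nat \<Rightarrow> nat) \<Rightarrow> (nat \<Rightarrow> nat \<Rightarrow> nat) set" where
  "gt_patterns n lam = {d. d 0 = lam \<and> (\<forall>i l. d (Suc i) l \<le> d i l) \<and>
     (\<forall>i l. d i (Suc l) \<le> d (Suc i) l) \<and> (\<forall>i\<ge>n. \<forall>l. d i l = 0)}"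

text \<open>For a pattern the subtraction never truncates and entries at positions from
  \<open>n\<close> on vanish, so this is the size of row \<open>i\<close> minus the size of row
  \<open>i + 1\<close>.\<close>

definition wt :: "nat \<Rightarrow> (nat \<Rightarrow> nat \<Rightarrow> nat) \<Rightarrow> nat \<Rightarrow> nat" where
  "wt n d i = (\<Sum>l<n. d i l - d (Suc i) l)"

text \<open>A value \<open>d i l\<close> is the length of row \<open>l\<close> in the subtableau of
  letters below \<open>n - i\<close>. Capping all values at \<open>J\<close> thus keeps the first
  \<open>J\<close> columns of the tableau; \<open>over J\<close> keeps the remaining ones.\<close>

definition cut :: "nat \<Rightarrow> (nat \<Rightarrow> nat \<Rightarrow> nat) \<Rightarrow> nat \<Rightarrow> nat \<Rightarrow> nat" where
  "cut J d = (\<lambda>i l. min (d i l) J)"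

definition over :: "nat \<Rightarrow> (nat \<Rightarrow> nat \<Rightarrow> nat) \<Rightarrow> nat \<Rightarrow> nat \<Rightarrow> nat" where
  "over J d = (\<lambda>i l. d i l - J)"

definition lo :: "(nat \<Rightarrow> nat) \<Rightarrow> (nat \<Rightarrow> nat) \<Rightarrow> nat \<Rightarrow> nat" where
  "lo p r l = max (p (Suc l)) (r l)"

definition hi :: "(nat \<Rightarrow> nat) \<Rightarrow> (nat \<Rightarrow> nat) \<Rightarrow> nat \<Rightarrow> nat" where
  "hi p r l = (case l of 0 \<Rightarrow> p 0 | Suc m \<Rightarrow> min (p l) (r m))"

text \<open>With the neighbours \<open>p\<close> and \<open>r\<close> fixed, interlacing confines
  each \<open>q l\<close> independently to the interval from \<open>lo\<close> to \<open>hi\<close>,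
  so entries can be reflected one by one. For \<open>J = 0\<close> this is the Bender-Knuth
  involution; in general only the part of the interval from \<open>J\<close> upwards is
  reflected.\<close>

definition toggle_row :: "nat \<Rightarrow> (nat \<Rightarrow> nat) \<Rightarrow> (nat \<Rightarrow> nat) \<Rightarrow> (nat \<Rightarrow> nat) \<Rightarrow> nat \<Rightarrow> nat" where
  "toggle_row J p q r l = (if q l < J then q l else max J (lo p r l) + hi p r l - q l)"

definition toggle :: "nat \<Rightarrow> nat \<Rightarrow> (nat \<Rightarrow> nat \<Rightarrow> nat) \<Rightarrow> nat \<Rightarrow> nat \<Rightarrow> nat" where
  "toggle J i d = d(Suc i := toggle_row J (d i) (d (Suc i)) (d (Suc (Suc i))))"

lemma gt_patternsD:
  assumes "d \<in> gt_patterns n lam"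
  shows "d 0 = lam" "d (Suc i) l \<le> d i l" "d i (Suc l) \<le> d (Suc i) l" "n \<le> i \<Longrightarrow> d i l = 0"
  using assms by (auto simp: gt_patterns_def)

lemma gt_patterns_le:
  assumes "d \<in> gt_patterns n lam"
  shows "d i l \<le> lam l"
  using gt_patternsD(1,2)[OF assms] by (induction i) (auto intro: le_trans)

lemma gt_patterns_row_antimono:
  assumes "d \<in> gt_patterns n lam"
  shows "d i (Suc l) \<le> d i l"
  using gt_patternsD(2,3)[OF assms] le_trans by blast

text \<open>Going one row down and one position left keeps \<open>i + l\<close> and never lowers the
  value; the walk ends in a zero row.\<close>

lemma gt_patterns_zero:
  assumes "d \<in> gt_patterns n lam" "n \<le> i + l"
  shows "d i l = 0"
  using assms(2)
proof (induction l arbitrary: i)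
  case 0
  then show ?case using gt_patternsD(4)[OF assms(1)] by simp
next
  case (Suc l)
  then have "d (Suc i) l = 0" by simp
  then show ?case using gt_patternsD(3)[OF assms(1), of i l] by simp
qed

lemma wt_sum:
  assumes "\<And>l. d (Suc i) l \<le> d i l"
  shows "wt n d i + (\<Sum>l<n. d (Suc i) l) = (\<Sum>l<n. d i l)"
  by (simp add: wt_def assms flip: sum.distrib)

lemma wt_cut_over:
  assumes "\<And>l. d (Suc i) l \<le> d i l"
  shows "wt n d i = wt n (cut J d) i + wt n (over J d) i"
proof -
  have "d i l - d (Suc i) l =
      (min (d i l) J - min (d (Suc i) l) J) + ((d i l - J) - (d (Suc i) l - J))" for l
    using assms[of l] by auto
  then show ?thesis by (simp add: wt_def cut_def over_def flip: sum.distrib)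
qed

section \<open>Reflecting one row between its two neighbours\<close>

lemma lo_hi:
  assumes "\<And>l. q l \<le> p l" "\<And>l. p (Suc l) \<le> q l" "\<And>l. r l \<le> q l" "\<And>l. q (Suc l) \<le> r l"
  shows "lo p r l \<le> q l" "q l \<le> hi p r l"
  by (simp_all add: lo_def hi_def assms split: nat.split)

lemma lo_hiD:
  assumes "\<And>l. lo p r l \<le> q l" "\<And>l. q l \<le> hi p r l"
  shows "q l \<le> p l" "p (Suc l) \<le> q l" "r l \<le> q l" "q (Suc l) \<le> r l"
proof -
  show "q l \<le> p l" using assms(2)[of l] by (simp add: hi_def split: nat.split_asm)
  show "p (Suc l) \<le> q l" "r l \<le> q l" using assms(1)[of l] by (simp_all add: lo_def)
  show "q (Suc l) \<le> r l" using assms(2)[of "Suc l"] by (simp add: hi_def)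
qed

lemma toggle_row_bounds:
  assumes "lo p r l \<le> q l" "q l \<le> hi p r l"
  shows "lo p r l \<le> toggle_row J p q r l" "toggle_row J p q r l \<le> hi p r l"
    "toggle_row J p q r l < J \<longleftrightarrow> q l < J"
  using assms by (auto simp: toggle_row_def)

lemma toggle_row_toggle_row:
  assumes "lo p r l \<le> q l" "q l \<le> hi p r l"
  shows "toggle_row J p (toggle_row J p q r) r l = q l"
proof (cases "q l < J")
  case False
  then have "\<not> toggle_row J p q r l < J" using toggle_row_bounds(3)[of p r l q J] assms by simp
  then have "toggle_row J p (toggle_row J p q r) r l =
      max J (lo p r l) + hi p r l - (max J (lo p r l) + hi p r l - q l)"
    using False by (simp add: toggle_row_def)
  then show ?thesis using assms by simp
qed (simp add: toggle_row_def)

text \<open>The \<open>max\<close> at position \<open>l\<close> and the \<open>min\<close> at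
  position \<open>Suc l\<close> involve the same two numbers. What remains unpaired is
  \<open>p 0\<close> and, because \<open>p n = 0\<close>, the last entry of \<open>r\<close>.
  Consequently a full reflection exchanges the weights of two adjacent rows.\<close>

lemma sum_lo_hi:
  assumes "p n = 0"
  shows "(\<Sum>l<n. lo p r l) + (\<Sum>l<n. hi p r l) = (\<Sum>l<n. p l) + (\<Sum>l<n. r l)"
proof (cases n)
  case (Suc m)
  have eq: "max a b + min a b = a + b" for a b :: nat
    by auto
  have "(\<Sum>l<m. max (p (Suc l)) (r l)) + (\<Sum>l<m. min (p (Suc l)) (r l)) =
      (\<Sum>l<m. p (Suc l)) + (\<Sum>l<m. r l)"
    by (simp only: eq flip: sum.distrib)
  moreover have "(\<Sum>l<Suc m. lo p r l) = (\<Sum>l<m. max (p (Suc l)) (r l)) + r m"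
    using assms Suc by (simp add: lo_def)
  moreover have "(\<Sum>l<Suc m. hi p r l) = p 0 + (\<Sum>l<m. min (p (Suc l)) (r l))"
    by (subst sum.lessThan_Suc_shift) (simp add: hi_def)
  moreover have "(\<Sum>l<Suc m. p l) = p 0 + (\<Sum>l<m. p (Suc l))"
    by (subst sum.lessThan_Suc_shift) simp
  ultimately show ?thesis using Suc by simp
qed simp

text \<open>Above level \<open>J\<close> the toggle is the full reflection of the truncated row
  between its truncated neighbours. At a position with \<open>q l < J\<close> nothing moves, and
  \<open>clean\<close> makes the truncated interval there collapse to zero, so the identity
  persists.\<close>

lemma toggle_row_sum:
  assumes bounds: "\<And>l. lo p r l \<le> q l" "\<And>l. q l \<le> hi p r l"
    and "p n = 0" and clean: "\<And>l. q l < J \<Longrightarrow> p l \<le> J"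
  shows "(\<Sum>l<n. toggle_row J p q r l) + (\<Sum>l<n. q l - J) =
    (\<Sum>l<n. min (q l) J) + (\<Sum>l<n. p l - J) + (\<Sum>l<n. r l - J)"
proof -
  let ?p = "\<lambda>l. p l - J" and ?r = "\<lambda>l. r l - J"
  have lo: "lo ?p ?r l = lo p r l - J" for l
    by (simp add: lo_def)
  have hi: "hi ?p ?r l = hi p r l - J" for l
    by (auto simp: hi_def min_def split: nat.split)
  have *: "toggle_row J p q r l + (q l - J) = min (q l) J + (lo ?p ?r l + hi ?p ?r l)" for l
  proof (cases "q l < J")
    case True
    then have "lo p r l \<le> J" "hi p r l \<le> J"
      using bounds[of l] clean[of l] by (auto simp: hi_def min_def split: nat.split)
    then show ?thesis using True by (simp add: toggle_row_def lo hi)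
  next
    case False
    then show ?thesis using bounds[of l] by (simp add: toggle_row_def lo hi)
  qed
  have "(\<Sum>l<n. toggle_row J p q r l) + (\<Sum>l<n. q l - J) =
      (\<Sum>l<n. min (q l) J) + ((\<Sum>l<n. lo ?p ?r l) + (\<Sum>l<n. hi ?p ?r l))"
    by (simp only: * flip: sum.distrib)
  also have "(\<Sum>l<n. lo ?p ?r l) + (\<Sum>l<n. hi ?p ?r l) = (\<Sum>l<n. ?p l) + (\<Sum>l<n. ?r l)"
    by (rule sum_lo_hi) (simp add: \<open>p n = 0\<close>)
  finally show ?thesis by (simp only: add.assoc)
qed

section \<open>Toggles acting on whole patterns\<close>

lemma gt_patterns_lo_hi:
  assumes "d \<in> gt_patterns n lam"
  shows "lo (d i) (d (Suc (Suc i))) l \<le> d (Suc i) l" "d (Suc i) l \<le> hi (d i) (d (Suc (Suc i))) l"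
  using gt_patternsD(2,3)[OF assms] by (auto intro!: lo_hi)

lemma toggle_in_gt_patterns:
  assumes "d \<in> gt_patterns n lam" "Suc i < n"
  shows "toggle J i d \<in> gt_patterns n lam"
proof -
  let ?p = "d i" and ?q = "d (Suc i)" and ?r = "d (Suc (Suc i))"
  have "lo ?p ?r l \<le> toggle_row J ?p ?q ?r l" "toggle_row J ?p ?q ?r l \<le> hi ?p ?r l" for l
    using gt_patterns_lo_hi[OF assms(1), of i l] by (rule toggle_row_bounds)+
  note lo_hiD[OF this]
  then show ?thesis
    using gt_patternsD[OF assms(1)] assms(2) by (simp add: gt_patterns_def toggle_def)
qed

lemma toggle_toggle:
  assumes "d \<in> gt_patterns n lam"
  shows "toggle J i (toggle J i d) = d"
  using toggle_row_toggle_row[where q = "d (Suc i)", OF gt_patterns_lo_hi[OF assms]]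
  by (simp add: toggle_def fun_eq_iff)

text \<open>A reflected entry stays at or above \<open>J\<close>, because the lower end of its
  interval is raised to \<open>J\<close>. A violation located by the first \<open>J\<close> columns
  is therefore still visible after the toggle.\<close>

lemma cut_toggle:
  assumes "d \<in> gt_patterns n lam"
  shows "cut J (toggle J i d) = cut J d"
proof -
  have "min (toggle_row J (d i) (d (Suc i)) (d (Suc (Suc i))) l) J = min (d (Suc i) l) J" for l
    using toggle_row_bounds(3)[where q = "d (Suc i)" and l = l and J = J, OF gt_patterns_lo_hi[OF assms]]
    by (cases "d (Suc i) l < J") (auto simp: toggle_row_def)
  then show ?thesis by (auto simp: toggle_def cut_def fun_eq_iff)
qed

lemma wt_toggle:
  assumes d: "d \<in> gt_patterns n lam" and i: "Suc i < n"
    and clean: "\<And>l. d (Suc i) l < J \<Longrightarrow> d i l \<le> J"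
  shows "wt n (toggle J i d) i = wt n (cut J d) i + wt n (over J d) (Suc i)"
    and "wt n (toggle J i d) (Suc i) = wt n (cut J d) (Suc i) + wt n (over J d) i"
    and "j \<noteq> i \<Longrightarrow> j \<noteq> Suc i \<Longrightarrow> wt n (toggle J i d) j = wt n d j"
proof -
  let ?p = "d i" and ?q = "d (Suc i)" and ?r = "d (Suc (Suc i))" and ?t = "toggle J i d"
  note D = gt_patternsD[OF d]
  note T = gt_patternsD[OF toggle_in_gt_patterns[OF d i, of J]]
  have t: "?t i = ?p" "?t (Suc i) = toggle_row J ?p ?q ?r" "?t (Suc (Suc i)) = ?r"
    by (auto simp: toggle_def)
  have split: "(\<Sum>l<n. d m l) = (\<Sum>l<n. min (d m l) J) + (\<Sum>l<n. d m l - J)" for m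
    by (auto intro!: sum.cong simp flip: sum.distrib)
  have S: "(\<Sum>l<n. ?t (Suc i) l) + (\<Sum>l<n. ?q l - J) =
      (\<Sum>l<n. min (?q l) J) + (\<Sum>l<n. ?p l - J) + (\<Sum>l<n. ?r l - J)"
    unfolding t
    by (rule toggle_row_sum) (use gt_patterns_lo_hi[OF d] clean gt_patterns_zero[OF d, of i n] in auto)
  have c: "wt n (cut J d) m + (\<Sum>l<n. min (d (Suc m) l) J) = (\<Sum>l<n. min (d m l) J)" for m
    using wt_sum[of "cut J d" m n] D(2)[of m] by (simp add: cut_def min.coboundedI1)
  have o: "wt n (over J d) m + (\<Sum>l<n. d (Suc m) l - J) = (\<Sum>l<n. d m l - J)" for m
    using wt_sum[of "over J d" m n] D(2)[of m] by (simp add: over_def diff_le_mono)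
  have a: "wt n ?t i + (\<Sum>l<n. ?t (Suc i) l) = (\<Sum>l<n. ?p l)"
    using wt_sum[of ?t i n, OF T(2)] by (simp only: t)
  have b: "wt n ?t (Suc i) + (\<Sum>l<n. ?r l) = (\<Sum>l<n. ?t (Suc i) l)"
    using wt_sum[of ?t "Suc i" n, OF T(2)] by (simp only: t)
  show "wt n ?t i = wt n (cut J d) i + wt n (over J d) (Suc i)"
    using a S c[of i] o[of "Suc i"] split[of i] by linarith
  show "wt n ?t (Suc i) = wt n (cut J d) (Suc i) + wt n (over J d) i"
    using b S c[of "Suc i"] o[of i] split[of "Suc (Suc i)"] by linarith
  show "j \<noteq> i \<Longrightarrow> j \<noteq> Suc i \<Longrightarrow> wt n ?t j = wt n d j"
    by (simp add: wt_def toggle_def)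
qed

text \<open>At threshold 0 the condition on small entries is vacuous and every column counts as
  beyond the threshold, so the whole weights of the two rows are exchanged.\<close>

lemma wt_toggle_0:
  assumes "d \<in> gt_patterns n lam" "Suc i < n"
  shows "wt n (toggle 0 i d) = wt n d \<circ> transpose i (Suc i)"
proof
  fix j
  have "wt n (cut 0 d) m = 0" "over 0 d = d" for m
    by (auto simp: wt_def cut_def over_def)
  then show "wt n (toggle 0 i d) j = (wt n d \<circ> transpose i (Suc i)) j"
    using wt_toggle(1,2)[OF assms, where J = 0] wt_toggle(3)[OF assms, where J = 0 and j = j] by (auto simp: transpose_def)
qed

section \<open>Dominance and its first violation\<close>

definition dominant :: "nat \<Rightarrow> (nat \<Rightarrow> nat) \<Rightarrow> (nat \<Rightarrow> nat \<Rightarrow> nat) \<Rightarrow> bool" where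
  "dominant n mu d \<longleftrightarrow>
     (\<forall>J i. mu (Suc i) + wt n (cut J d) (Suc i) \<le> mu i + wt n (cut J d) i)"

text \<open>The cardinality counts the cells of column \<open>J\<close>, numbered from 0, that carry
  the letter of row \<open>i\<close>.\<close>

lemma wt_cut_Suc:
  assumes "\<And>l. d (Suc i) l \<le> d i l"
  shows "wt n (cut (Suc J) d) i = wt n (cut J d) i + card {l. l < n \<and> d (Suc i) l \<le> J \<and> J < d i l}"
proof -
  have "min (d i l) (Suc J) - min (d (Suc i) l) (Suc J) =
      (min (d i l) J - min (d (Suc i) l) J) + (if d (Suc i) l \<le> J \<and> J < d i l then 1 else 0)" for l
    using assms[of l] by auto
  moreover have "(\<Sum>l<n. if d (Suc i) l \<le> J \<and> J < d i l then 1 else 0) =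
      card {l. l < n \<and> d (Suc i) l \<le> J \<and> J < d i l}"
    by (simp add: sum.If_cases Int_def conj_commute)
  ultimately show ?thesis by (simp add: wt_def cut_def sum.distrib)
qed

text \<open>This is column strictness: two such positions \<open>l < m\<close> would give
  \<open>J < d i m \<le> d (Suc i) l \<le> J\<close>.\<close>

lemma card_column_le_1:
  assumes d: "d \<in> gt_patterns n lam"
  shows "card {l. l < n \<and> d (Suc i) l \<le> J \<and> J < d i l} \<le> 1" (is "card ?A \<le> 1")
proof -
  have anti: "d i l \<le> d (Suc i) m" if "m < l" for l m
  proof -
    have "d i l \<le> d i (Suc m)"
      by (rule lift_Suc_antimono_le[of "d i"]) (use that gt_patterns_row_antimono[OF d] in simp_all)
    then show ?thesis using gt_patternsD(3)[OF d, of i m] by simp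
  qed
  have "l = m" if "d (Suc i) l \<le> J" "J < d i l" "d (Suc i) m \<le> J" "J < d i m" for l m
    using that anti[of l m] anti[of m l] by (cases l m rule: linorder_cases) auto
  then have "\<forall>a\<in>?A. \<forall>b\<in>?A. a = b" by simp
  moreover have "finite ?A" by simp
  ultimately show ?thesis using card_le_Suc0_iff_eq[of ?A] by simp
qed

text \<open>One more column adds at most 1 to a weight. At the first failure the excess is therefore
  exactly 1, and the last column contains the letter of row \<open>Suc i\<close> but not that of row
  \<open>i\<close>. The absence gives the condition required for the toggle; the excess of 1 will be
  matched by the step of \<rho>.\<close>

lemma not_dominantE:
  assumes d: "d \<in> gt_patterns n lam" and mu: "antimono mu" "\<forall>i\<ge>n. mu i = 0"
    and J: "mu i + wt n (cut J d) i < mu (Suc i) + wt n (cut J d) (Suc i)"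
    and least: "\<And>J' i. J' < J \<Longrightarrow>
      mu (Suc i) + wt n (cut J' d) (Suc i) \<le> mu i + wt n (cut J' d) i"
  shows "Suc i < n" "\<And>l. d (Suc i) l < J \<Longrightarrow> d i l \<le> J"
    "mu (Suc i) + wt n (cut J d) (Suc i) = Suc (mu i + wt n (cut J d) i)"
proof -
  note D = gt_patternsD[OF d]
  show i: "Suc i < n"
  proof (rule ccontr)
    assume "\<not> Suc i < n"
    then have "wt n (cut J d) (Suc i) = 0" "mu (Suc i) = 0"
      using D(4) mu by (auto simp: wt_def cut_def)
    then show False using J by simp
  qed
  have "J \<noteq> 0"
  proof
    assume "J = 0"
    then have "wt n (cut J d) m = 0" for m by (simp add: wt_def cut_def)
    then show False using J antimonoD[OF mu(1), of i "Suc i"] by simp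
  qed
  then obtain j where j: "J = Suc j" using not0_implies_Suc by blast
  let ?c = "\<lambda>i. card {l. l < n \<and> d (Suc i) l \<le> j \<and> j < d i l}"
  have "wt n (cut J d) m = wt n (cut j d) m + ?c m" for m
    unfolding j by (rule wt_cut_Suc) (rule D)
  moreover have "?c (Suc i) \<le> 1" by (rule card_column_le_1[OF d])
  moreover have "mu (Suc i) + wt n (cut j d) (Suc i) \<le> mu i + wt n (cut j d) i"
    using least j by simp
  ultimately have c: "?c i = 0 \<and>
      mu (Suc i) + wt n (cut J d) (Suc i) = Suc (mu i + wt n (cut J d) i)"
    using J by presburger
  show "mu (Suc i) + wt n (cut J d) (Suc i) = Suc (mu i + wt n (cut J d) i)" using c by blast
  have "{l. l < n \<and> d (Suc i) l \<le> j \<and> j < d i l} = {}"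
    using c card_eq_0_iff[of "{l. l < n \<and> d (Suc i) l \<le> j \<and> j < d i l}"] by simp
  then have "\<forall>l<n. d (Suc i) l \<le> j \<longrightarrow> d i l \<le> j" by (auto simp: not_less)
  moreover have "\<forall>l\<ge>n. d i l = 0" using gt_patterns_zero[OF d] by simp
  ultimately show "d (Suc i) l < J \<Longrightarrow> d i l \<le> J" for l
    unfolding j by (cases "l < n") (auto simp: less_Suc_eq_le intro: le_SucI)
qed

section \<open>Alternants and Schur polynomials\<close>

definition expo :: "nat \<Rightarrow> (nat \<Rightarrow> nat) \<Rightarrow> (nat \<Rightarrow>\<^sub>0 nat)" where
  "expo n b = Abs_poly_mapping (\<lambda>i. if i < n then b i else 0)"

text \<open>The determinant with entries \<open>x_i\<close> to the power \<open>b j\<close>, as an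
  element of a polynomial ring over the integers, which is an integral domain; the cancellation of
  the Vandermonde factor depends on that.\<close>

definition alternant :: "nat \<Rightarrow> (nat \<Rightarrow> nat) \<Rightarrow> (nat \<Rightarrow>\<^sub>0 nat) \<Rightarrow>\<^sub>0 int" where
  "alternant n b = (\<Sum>w | w permutes {..<n}. Poly_Mapping.single (expo n (b \<circ> w)) (sign w))"

definition gt_poly :: "nat \<Rightarrow> (nat \<Rightarrow> nat) \<Rightarrow> (nat \<Rightarrow>\<^sub>0 nat) \<Rightarrow>\<^sub>0 int" where
  "gt_poly n lam = (\<Sum>d\<in>gt_patterns n lam. Poly_Mapping.single (expo n (wt n d)) 1)"

definition shifted :: "nat \<Rightarrow> (nat \<Rightarrow> nat) \<Rightarrow> nat \<Rightarrow> nat" where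
  "shifted n lam i = lam i + (n - 1 - i)"

lemma lookup_expo: "Poly_Mapping.lookup (expo n b) i = (if i < n then b i else 0)"
  by (simp add: expo_def)

lemma expo_eq_iff: "expo n b = expo n c \<longleftrightarrow> (\<forall>i<n. b i = c i)"
  by (auto simp: poly_mapping_eq_iff fun_eq_iff lookup_expo)

lemma expo_add: "expo n b + expo n c = expo n (\<lambda>i. b i + c i)"
  by (auto simp: poly_mapping_eq_iff fun_eq_iff lookup_expo lookup_add)

lemma finite_gt_patterns:
  assumes "antimono lam"
  shows "finite (gt_patterns n lam)"
proof -
  let ?B = "{g. \<forall>l. (l \<in> {..<n} \<longrightarrow> g l \<in> {..lam 0}) \<and> (l \<notin> {..<n} \<longrightarrow> g l = 0)}"
  let ?A = "{d. \<forall>i. (i \<in> {..<n} \<longrightarrow> d i \<in> ?B) \<and> (i \<notin> {..<n} \<longrightarrow> d i = (\<lambda>_. 0))}"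
  have "finite ?B" by (rule finite_set_of_finite_funs) simp_all
  then have "finite ?A" by (intro finite_set_of_finite_funs) simp_all
  moreover have "gt_patterns n lam \<subseteq> ?A"
  proof
    fix d assume d: "d \<in> gt_patterns n lam"
    have "d i l \<le> lam 0" for i l
      using gt_patterns_le[OF d, of i l] antimonoD[OF assms, of 0 l] by simp
    then show "d \<in> ?A" using gt_patterns_zero[OF d] by (auto simp: fun_eq_iff)
  qed
  ultimately show ?thesis by (rule finite_subset[rotated])
qed

text \<open>\<open>toggle 0 i\<close> realises the adjacent transposition on weights. Longer
  transpositions are conjugates of shorter ones by adjacent ones, and transpositions generate all
  permutations.\<close>

lemma expo_wt_symmetric:
  assumes w: "w permutes {..<n}"
  shows "(\<Sum>d\<in>gt_patterns n lam. Poly_Mapping.single (expo n (wt n d \<circ> w)) (c::int)) =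
    (\<Sum>d\<in>gt_patterns n lam. Poly_Mapping.single (expo n (wt n d)) c)"
proof -
  let ?f = "\<lambda>w. \<Sum>d\<in>gt_patterns n lam. Poly_Mapping.single (expo n (wt n d \<circ> w)) c"
  have adj: "?f (transpose i (Suc i) \<circ> w) = ?f w" if "Suc i < n" for i and w :: "nat \<Rightarrow> nat"
    by (rule sum.reindex_bij_witness[of _ "toggle 0 i" "toggle 0 i"])
      (simp_all add: toggle_in_gt_patterns toggle_toggle[of _ n lam] wt_toggle_0 that comp_assoc)
  have step: "?f (transpose a (a + Suc m) \<circ> w) = ?f w" if "a + Suc m < n"
    for a m and w :: "nat \<Rightarrow> nat"
    using that
  proof (induction m arbitrary: w)
    case 0
    then show ?case using adj[of a w] by (simp only: add_Suc_right add_0_right)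
  next
    case (Suc m)
    let ?b = "a + Suc m"
    have "transpose a (Suc ?b) = transpose ?b (Suc ?b) \<circ> transpose a ?b \<circ> transpose ?b (Suc ?b)"
      by (auto simp: fun_eq_iff transpose_def)
    then have "?f (transpose a (a + Suc (Suc m)) \<circ> w) =
        ?f (transpose ?b (Suc ?b) \<circ> (transpose a ?b \<circ> (transpose ?b (Suc ?b) \<circ> w)))"
      by (simp add: comp_assoc)
    also have "\<dots> = ?f w"
      using Suc by (simp only: adj)
    finally show ?case .
  qed
  have transposition: "?f (transpose a b \<circ> w) = ?f w" if "a < n" "b < n" "a \<noteq> b"
    for a b and w :: "nat \<Rightarrow> nat"
  proof (cases "a < b")
    case True
    then obtain m where "b = a + Suc m" using less_imp_Suc_add by auto
    then show ?thesis using step that by simp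
  next
    case False
    then have "b < a" using that by simp
    then obtain m where "a = b + Suc m" using less_imp_Suc_add by auto
    then show ?thesis using step[of b m w] that by (simp add: transpose_commute)
  qed
  show ?thesis using w finite_lessThan
  proof (induction rule: permutes_induct)
    case (swap a b p)
    then have "?f (transpose a b \<circ> p) = ?f p" by (intro transposition) auto
    then show ?case using swap.IH by (rule trans)
  qed simp_all
qed

lemma alternant_cong:
  assumes "\<And>i. i < n \<Longrightarrow> b i = c i"
  shows "alternant n b = alternant n c"
  unfolding alternant_def
proof (intro sum.cong refl)
  fix w assume "w \<in> {w. w permutes {..<n}}"
  then have "expo n (b \<circ> w) = expo n (c \<circ> w)"
    using permutes_in_image[of w "{..<n}"] assms by (auto simp: expo_eq_iff)
  then show "Poly_Mapping.single (expo n (b \<circ> w)) (sign w) =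
      Poly_Mapping.single (expo n (c \<circ> w)) (sign w)" by simp
qed

lemma alternant_transpose:
  assumes "Suc i < n"
  shows "alternant n (b \<circ> transpose i (Suc i)) = - alternant n b"
proof -
  let ?t = "transpose i (Suc i)"
  have t: "?t permutes {..<n}" using assms by (intro permutes_swap_id) auto
  have "alternant n b = (\<Sum>w | w permutes {..<n}.
      Poly_Mapping.single (expo n (b \<circ> (?t \<circ> w))) (sign (?t \<circ> w)))"
    unfolding alternant_def by (rule setum_permutations_compose_left[OF t])
  also have "\<dots> = (\<Sum>w | w permutes {..<n}. - Poly_Mapping.single (expo n (b \<circ> ?t \<circ> w)) (sign w))"
  proof (intro sum.cong refl)
    fix w assume "w \<in> {w. w permutes {..<n}}"
    then have "permutation w" using permutation_permutes by blast
    then have "sign (?t \<circ> w) = - sign w"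
      using sign_compose[of ?t w] permutation_swap_id[of i "Suc i"] by (simp add: sign_swap_id)
    then show "Poly_Mapping.single (expo n (b \<circ> (?t \<circ> w))) (sign (?t \<circ> w)) =
        - Poly_Mapping.single (expo n (b \<circ> ?t \<circ> w)) (sign w)"
      by (simp add: comp_assoc single_uminus)
  qed
  also have "\<dots> = - alternant n (b \<circ> ?t)" by (simp add: alternant_def sum_negf)
  finally show ?thesis by simp
qed

text \<open>By symmetry the Schur factor may be permuted by the same \<open>w\<close> that indexes
  the term of the alternant, so the exponents combine to one sequence composed with
  \<open>w\<close>.\<close>

lemma alternant_mult_gt_poly:
  "alternant n b * gt_poly n lam = (\<Sum>d\<in>gt_patterns n lam. alternant n (\<lambda>i. b i + wt n d i))"
proof -
  have "alternant n b * gt_poly n lam = (\<Sum>w | w permutes {..<n}.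
      Poly_Mapping.single (expo n (b \<circ> w)) (sign w) *
      (\<Sum>d\<in>gt_patterns n lam. Poly_Mapping.single (expo n (wt n d)) 1))"
    by (simp only: alternant_def gt_poly_def sum_distrib_right)
  also have "\<dots> = (\<Sum>w | w permutes {..<n}.
      Poly_Mapping.single (expo n (b \<circ> w)) (sign w) *
      (\<Sum>d\<in>gt_patterns n lam. Poly_Mapping.single (expo n (wt n d \<circ> w)) 1))"
    by (intro sum.cong refl arg_cong2[of _ _ _ _ "(*)"] expo_wt_symmetric[symmetric]) simp
  also have "\<dots> = (\<Sum>w | w permutes {..<n}. \<Sum>d\<in>gt_patterns n lam.
      Poly_Mapping.single (expo n ((\<lambda>i. b i + wt n d i) \<circ> w)) (sign w))"
    by (simp add: sum_distrib_left mult_single expo_add comp_def)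
  also have "\<dots> = (\<Sum>d\<in>gt_patterns n lam. alternant n (\<lambda>i. b i + wt n d i))"
    unfolding alternant_def by (rule sum.swap)
  finally show ?thesis .
qed

text \<open>Reindexing along \<open>f\<close> shows that the sum equals its own negative. Fixed
  points are allowed: there \<open>g x = - g x\<close>, so they contribute zero.\<close>

lemma sum_sign_reversing:
  fixes g :: "'a \<Rightarrow> 'b :: {ring_no_zero_divisors, ring_char_0}"
  assumes "\<And>x. x \<in> A \<Longrightarrow> f x \<in> A" "\<And>x. x \<in> A \<Longrightarrow> f (f x) = x" "\<And>x. x \<in> A \<Longrightarrow> g (f x) = - g x"
  shows "sum g A = 0"
proof -
  have "sum g A = (\<Sum>x\<in>A. g (f x))"
    by (rule sum.reindex_bij_witness[of _ f f]) (use assms in simp_all)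
  also have "\<dots> = - sum g A" using assms(3) by (simp add: sum_negf)
  finally have "2 * sum g A = 0" by (simp add: mult_2 eq_neg_iff_add_eq_0)
  then show ?thesis by simp
qed

text \<open>Stembridge's cancellation: at the first column where dominance fails, toggling the
  columns to its right exchanges two entries of the shifted weight.\<close>
lemma alternant_nondominant_sum:
  assumes mu: "antimono mu" "\<forall>i\<ge>n. mu i = 0"
  shows "(\<Sum>d | d \<in> gt_patterns n lam \<and> \<not> dominant n mu d.
    alternant n (\<lambda>i. shifted n mu i + wt n d i)) = 0"
proof -
  define viol where "viol d J i \<longleftrightarrow>
    mu i + wt n (cut J d) i < mu (Suc i) + wt n (cut J d) (Suc i)" for d J i
  define col where "col d = (LEAST J. \<exists>i. viol d J i)" for d
  define row where "row d = (LEAST i. viol d (col d) i)" for d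
  define flip where "flip d = toggle (col d) (row d) d" for d
  define A where "A = {d. d \<in> gt_patterns n lam \<and> \<not> dominant n mu d}"
  have dom: "dominant n mu d \<longleftrightarrow> (\<forall>J i. \<not> viol d J i)" for d
    by (auto simp: dominant_def viol_def not_less)
  have viol: "viol d (col d) (row d)" and least: "\<And>J i. J < col d \<Longrightarrow> \<not> viol d J i" if "d \<in> A" for d
  proof -
    obtain J i where "viol d J i" using \<open>d \<in> A\<close> by (auto simp: A_def dom)
    then have "\<exists>i. viol d (col d) i" unfolding col_def by (rule LeastI_ex[OF exI, OF exI])
    then show "viol d (col d) (row d)" unfolding row_def by (rule LeastI_ex)
    show "\<not> viol d J i" if "J < col d" for J i
      using not_less_Least[OF that[unfolded col_def]] by blast
  qed
  have props: "Suc (row d) < n" "\<And>l. d (Suc (row d)) l < col d \<Longrightarrow> d (row d) l \<le> col d"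
    "mu (Suc (row d)) + wt n (cut (col d) d) (Suc (row d)) = Suc (mu (row d) + wt n (cut (col d) d) (row d))"
    "d \<in> gt_patterns n lam"
    if d: "d \<in> A" for d
    using not_dominantE[OF _ mu viol[OF d, unfolded viol_def]] least[OF d] d
    by (auto simp: A_def viol_def not_less)
  \<comment> \<open>Violations up to threshold \<open>col d\<close> depend only on the first
    \<open>col d\<close> columns, which the toggle preserves. So \<open>flip\<close> finds the same
    column and row again and is an involution.\<close>
  have same: "viol (flip d) J i \<longleftrightarrow> viol d J i" if d: "d \<in> A" and "J \<le> col d" for d J i
  proof -
    have "cut (col d) (flip d) = cut (col d) d"
      unfolding flip_def using props(4)[OF d] by (rule cut_toggle)
    then have "cut J (cut (col d) (flip d)) = cut J (cut (col d) d)" by simp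
    then have "cut J (flip d) = cut J d"
      using \<open>J \<le> col d\<close> by (simp add: cut_def min.assoc min.absorb2)
    then show ?thesis by (simp add: viol_def)
  qed
  have col_flip: "col (flip d) = col d" if d: "d \<in> A" for d
    unfolding col_def[of "flip d"]
    by (rule Least_equality) (use same[OF d] viol[OF d] least[OF d] in \<open>auto simp: not_less[symmetric]\<close>)
  have row_flip: "row (flip d) = row d" if d: "d \<in> A" for d
    unfolding row_def col_flip[OF d] by (intro arg_cong[of _ _ Least] ext same[OF d order_refl])
  have flip_A: "flip d \<in> A" if d: "d \<in> A" for d
    using same[OF d order_refl] viol[OF d] toggle_in_gt_patterns[OF props(4,1)[OF d]]
    by (auto simp: A_def dom flip_def)
  have flip_flip: "flip (flip d) = d" if d: "d \<in> A" for d
    unfolding flip_def[of "flip d"] col_flip[OF d] row_flip[OF d]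
    unfolding flip_def by (rule toggle_toggle[OF props(4)[OF d]])
  have neg: "alternant n (\<lambda>i. shifted n mu i + wt n (flip d) i) =
      - alternant n (\<lambda>i. shifted n mu i + wt n d i)" if d: "d \<in> A" for d
  proof -
    let ?r = "row d"
    note p = props[OF d]
    note w = wt_toggle[OF p(4,1,2), folded flip_def]
    have split: "wt n d i = wt n (cut (col d) d) i + wt n (over (col d) d) i" for i
      using gt_patternsD(2)[OF p(4)] by (rule wt_cut_over)
    \<comment> \<open>The excess of 1 in row \<open>Suc ?r\<close> equals the drop of \<rho> from
      \<open>?r\<close> to \<open>Suc ?r\<close>: counting only the first \<open>col d\<close>
      columns, the two shifted exponents coincide. Exchanging the contributions of the other columns
      thus exchanges the exponents.\<close>
    have "shifted n mu i + wt n (flip d) i =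
        ((\<lambda>i. shifted n mu i + wt n d i) \<circ> transpose ?r (Suc ?r)) i" if "i < n" for i
    proof -
      consider "i = ?r" | "i = Suc ?r" | "i \<noteq> ?r" "i \<noteq> Suc ?r" by blast
      then show ?thesis
        using p(1,3) w(1,2) w(3)[of i] split[of ?r] split[of "Suc ?r"]
        by cases (simp_all add: shifted_def)
    qed
    then have "alternant n (\<lambda>i. shifted n mu i + wt n (flip d) i) =
        alternant n ((\<lambda>i. shifted n mu i + wt n d i) \<circ> transpose ?r (Suc ?r))"
      by (rule alternant_cong)
    then show ?thesis using alternant_transpose[OF p(1)] by simp
  qed
  show ?thesis
    unfolding A_def[symmetric]
    by (rule sum_sign_reversing[where f = flip]) (rule flip_A flip_flip neg; assumption)+
qed

lemma shifted_alternant_mult_gt_poly: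
  assumes "antimono lam" "antimono mu" "\<forall>i\<ge>n. mu i = 0"
  shows "alternant n (shifted n mu) * gt_poly n lam =
    (\<Sum>d | d \<in> gt_patterns n lam \<and> dominant n mu d. alternant n (shifted n (\<lambda>i. mu i + wt n d i)))"
proof -
  let ?g = "\<lambda>d. alternant n (\<lambda>i. shifted n mu i + wt n d i)"
  have "sum ?g (gt_patterns n lam) = sum ?g {d. d \<in> gt_patterns n lam \<and> dominant n mu d} +
      sum ?g {d. d \<in> gt_patterns n lam \<and> \<not> dominant n mu d}"
    by (subst sum.union_disjoint[symmetric])
      (auto simp: finite_gt_patterns[OF assms(1)] intro!: sum.cong)
  moreover have "shifted n (\<lambda>i. mu i + wt n d i) = (\<lambda>i. shifted n mu i + wt n d i)" for d
    by (simp add: shifted_def fun_eq_iff)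
  ultimately show ?thesis
    using alternant_nondominant_sum[OF assms(2,3), of lam] by (simp add: alternant_mult_gt_poly)
qed

section \<open>Dominant patterns and the product rule\<close>

text \<open>Dominance is tested at the threshold \<open>J = d (Suc i) j\<close>. Positions up to
  \<open>j\<close> then contribute nothing to the weight of row \<open>i\<close>, positions before
  \<open>j\<close> nothing to that of row \<open>Suc i\<close>, and the later values are at most
  \<open>J\<close>, so capping does not change them.\<close>

lemma dominant_rows:
  assumes d: "d \<in> gt_patterns n lam" and dom: "dominant n mu d" and "j < n"
  shows "mu (Suc i) + (\<Sum>l=j..<n. d (Suc i) l - d (Suc (Suc i)) l) \<le>
    mu i + (\<Sum>l=Suc j..<n. d i l - d (Suc i) l)"
proof -
  let ?p = "d i" and ?q = "d (Suc i)" and ?r = "d (Suc (Suc i))"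
  let ?J = "?q j"
  note D = gt_patternsD(2,3)[OF d]
  have anti: "?q m \<le> ?q l" if "l \<le> m" for l m
    by (rule lift_Suc_antimono_le[of ?q]) (use that gt_patterns_row_antimono[OF d] in simp_all)
  have "wt n (cut ?J d) i = (\<Sum>l=Suc j..<n. ?p l - ?q l)"
    unfolding wt_def cut_def
  proof (rule sum.mono_neutral_cong_right)
    show "\<forall>l\<in>{..<n} - {Suc j..<n}. min (?p l) ?J - min (?q l) ?J = 0"
      using anti by (auto simp: min.coboundedI2)
    fix l assume l: "l \<in> {Suc j..<n}"
    then have "?q (l - 1) \<le> ?J" "?p l \<le> ?q (l - 1)"
      using D(2)[of i "l - 1"] by (auto intro!: anti)
    then show "min (?p l) ?J - min (?q l) ?J = ?p l - ?q l"
      using D(1)[of i l] by simp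
  qed auto
  moreover have "wt n (cut ?J d) (Suc i) = (\<Sum>l=j..<n. ?q l - ?r l)"
    unfolding wt_def cut_def
  proof (rule sum.mono_neutral_cong_right)
    show "\<forall>l\<in>{..<n} - {j..<n}. min (?q l) ?J - min (?r l) ?J = 0"
    proof
      fix l assume "l \<in> {..<n} - {j..<n}"
      then have "?J \<le> ?q (Suc l)" by (auto intro!: anti)
      then show "min (?q l) ?J - min (?r l) ?J = 0" using D(2)[of "Suc i" l] by simp
    qed
    fix l assume "l \<in> {j..<n}"
    then have "?q l \<le> ?J" by (auto intro!: anti)
    then show "min (?q l) ?J - min (?r l) ?J = ?q l - ?r l"
      using D(1)[of "Suc i" l] by simp
  qed auto
  ultimately show ?thesis using dom unfolding dominant_def by metis
qed

text \<open>Take \<open>j\<close> to be the first position with \<open>?q j \<le> J\<close>. Between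
  \<open>?q j\<close> and \<open>?q (j - 1)\<close> the slack depends on \<open>J\<close> through
  \<open>min (?p j) J + min (?r (j - 1)) J - J\<close>. This is concave, so the two endpoints
  suffice, and they are the instances \<open>j\<close> and \<open>j - 1\<close> of
  \<open>rows\<close>.\<close>

lemma rows_dominant:
  assumes d: "d \<in> gt_patterns n lam" and mu: "antimono mu"
    and rows: "\<And>i j. j < n \<Longrightarrow> mu (Suc i) + (\<Sum>l=j..<n. d (Suc i) l - d (Suc (Suc i)) l) \<le>
      mu i + (\<Sum>l=Suc j..<n. d i l - d (Suc i) l)"
  shows "dominant n mu d"
  unfolding dominant_def
proof (intro allI)
  fix J i
  let ?p = "d i" and ?q = "d (Suc i)" and ?r = "d (Suc (Suc i))"
  note D = gt_patternsD(2,3)[OF d]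
  have anti: "?q m \<le> ?q l" if "l \<le> m" for l m
    by (rule lift_Suc_antimono_le[of ?q]) (use that gt_patterns_row_antimono[OF d] in simp_all)
  define j where "j = (LEAST l. ?q l \<le> J)"
  have "?q n \<le> J" using gt_patterns_zero[OF d] by simp
  then have qj: "?q j \<le> J" and jn: "j \<le> n" unfolding j_def by (rule LeastI, rule Least_le)
  have below: "J < ?q l" if "l < j" for l
    using not_less_Least[OF that[unfolded j_def]] by simp
  let ?P = "\<lambda>l. min (?p l) J - min (?q l) J" and ?Q = "\<lambda>l. min (?q l) J - min (?r l) J"
  have P0: "?P l = 0" if "l < j" for l
    using below[OF that] D(1)[of i l] by simp
  have Q0: "?Q l = 0" if "Suc l < j" for l
    using below[OF that] D(2)[of "Suc i" l] by simp
  have P1: "?P l = ?p l - ?q l" if "j < l" for l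
    using D(2)[of i "l - 1"] anti[of j "l - 1"] qj that D(1)[of i l] by (cases l) simp_all
  have Q1: "?Q l = ?q l - ?r l" if "j \<le> l" for l
    using anti[OF that] qj D(1)[of "Suc i" l] by simp
  show "mu (Suc i) + wt n (cut J d) (Suc i) \<le> mu i + wt n (cut J d) i"
  proof (cases "j = n")
    case True
    \<comment> \<open>Row \<open>Suc i\<close> has already vanished at position
      \<open>n - 1\<close>, so \<open>j = n\<close> is possible only for
      \<open>n = 0\<close>.\<close>
    have "?q (n - 1) = 0" using gt_patterns_zero[OF d, of "Suc i" "n - 1"] by simp
    then have "j \<le> n - 1" unfolding j_def by (intro Least_le) simp
    then have "n = 0" using True by simp
    then show ?thesis using antimonoD[OF mu, of i "Suc i"] by (simp add: wt_def)
  next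
    case False
    then have "j < n" using jn by simp
    have "wt n (cut J d) i = (\<Sum>l=j..<n. ?P l)"
      unfolding wt_def cut_def using P0 by (intro sum.mono_neutral_right) auto
    also have "\<dots> = ?P j + (\<Sum>l=Suc j..<n. ?P l)"
      by (rule sum.atLeast_Suc_lessThan[OF \<open>j < n\<close>])
    also have "(\<Sum>l=Suc j..<n. ?P l) = (\<Sum>l=Suc j..<n. ?p l - ?q l)"
      using P1 by (intro sum.cong) auto
    finally have P: "wt n (cut J d) i = ?P j + (\<Sum>l=Suc j..<n. ?p l - ?q l)" .
    have tail: "(\<Sum>l=j..<n. ?Q l) = (\<Sum>l=j..<n. ?q l - ?r l)"
      using Q1 by (intro sum.cong) auto
    show ?thesis
    proof (cases j)
      case 0
      then have "wt n (cut J d) (Suc i) = (\<Sum>l=j..<n. ?q l - ?r l)"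
        unfolding wt_def cut_def tail[symmetric] by (simp add: atLeast0LessThan)
      then show ?thesis using P rows[OF \<open>j < n\<close>, of i] by simp
    next
      case (Suc m)
      have "wt n (cut J d) (Suc i) = (\<Sum>l=m..<n. ?Q l)"
        unfolding wt_def cut_def using Q0 Suc by (intro sum.mono_neutral_right) auto
      also have "\<dots> = ?Q m + (\<Sum>l=j..<n. ?q l - ?r l)"
        using Suc \<open>j < n\<close> unfolding tail[symmetric] by (simp add: sum.atLeast_Suc_lessThan)
      finally have Q: "wt n (cut J d) (Suc i) = ?Q m + (\<Sum>l=j..<n. ?q l - ?r l)" .
      have "mu (Suc i) + ((?q m - ?r m) + (\<Sum>l=j..<n. ?q l - ?r l)) \<le>
          mu i + ((?p j - ?q j) + (\<Sum>l=Suc j..<n. ?p l - ?q l))"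
        using rows[of m i] Suc \<open>j < n\<close> by (simp add: sum.atLeast_Suc_lessThan)
      \<comment> \<open>In the first case the slack at \<open>J\<close> is at least that at
        \<open>?q m\<close>, in the second at least that at \<open>?q j\<close>.\<close>
      moreover have "?Q m + (?p j - ?q j) \<le> (?q m - ?r m) + ?P j \<or>
           ?Q m = 0"
        using below[of m] qj Suc D(1)[of i j] D(2)[of i m] D(1)[of "Suc i" m] by (simp add: min_def) arith
      ultimately show ?thesis using P Q rows[OF \<open>j < n\<close>, of i] by linarith
    qed
  qed
qed

lemma sum_telescope_nat:
  fixes f :: "nat \<Rightarrow> nat"
  assumes "\<And>l. f (Suc l) \<le> f l"
  shows "(\<Sum>l<n. f l - f (Suc l)) + f n = f 0"
proof (induction n)
  case (Suc n)
  then show ?case using assms[of n] by simp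
qed simp

text \<open>Each row must be the previous one without its first entry. Going upwards from the zero
  rows, the row condition at position 0 telescopes to a bound of the sum of row \<open>i + 1\<close>
  by the sum of row \<open>i\<close> without its first entry. Interlacing gives the reverse
  inequality entry by entry, so all entries agree.\<close>

lemma dominant_zero_patterns:
  assumes lam: "antimono lam" "\<forall>i\<ge>n. lam i = 0"
  shows "{d. d \<in> gt_patterns n lam \<and> dominant n (\<lambda>_. 0) d} = {\<lambda>i l. lam (i + l)}"
proof -
  let ?h = "\<lambda>i l. lam (i + l)"
  have dec: "lam (Suc i) \<le> lam i" for i using lam(1) by (simp add: antimono_def)
  have "?h \<in> gt_patterns n lam"
    using lam(2) dec by (simp add: gt_patterns_def)
  moreover have "dominant n (\<lambda>_. 0) ?h"
  proof -
    have "wt n (cut J ?h) i = min (lam i) J" for i J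
      using sum_telescope_nat[of "\<lambda>l. min (lam (i + l)) J" n] lam dec
      by (simp add: wt_def cut_def min.coboundedI1)
    then show ?thesis using dec by (simp add: dominant_def min.coboundedI1)
  qed
  moreover have "d = ?h" if d: "d \<in> gt_patterns n lam" "dominant n (\<lambda>_. 0) d" for d
  proof -
    note D = gt_patternsD[OF d(1)]
    have shift: "d i (Suc l) = d (Suc i) l" for i l
    proof (cases "i < n")
      case True
      then have "i \<le> n" by simp
      then show ?thesis
      proof (induction arbitrary: l rule: inc_induct)
        case base
        then show ?case by (simp add: D(4))
      next
        case (step i)
        have "(\<Sum>l=0..<n. d (Suc i) l - d (Suc i) (Suc l)) \<le> (\<Sum>l=Suc 0..<n. d i l - d (Suc i) l)"
          using dominant_rows[OF d, of 0 i] step by simp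
        moreover have "(\<Sum>l=0..<n. d (Suc i) l - d (Suc i) (Suc l)) = d (Suc i) 0"
          using sum_telescope_nat[of "d (Suc i)" n] gt_patterns_row_antimono[OF d(1)]
            gt_patterns_zero[OF d(1), of "Suc i" n] by (simp add: atLeast0LessThan)
        moreover have "(\<Sum>l=Suc 0..<n. d i l - d (Suc i) l) + (\<Sum>l=Suc 0..<n. d (Suc i) l)
            = (\<Sum>l=Suc 0..<n. d i l)"
          using D(2)[of i] by (simp flip: sum.distrib)
        moreover have "d (Suc i) 0 + (\<Sum>l=Suc 0..<n. d (Suc i) l) = (\<Sum>l=0..<n. d (Suc i) l)"
          using step by (simp add: sum.atLeast_Suc_lessThan)
        moreover have "(\<Sum>l=Suc 0..<n. d i l) = (\<Sum>l=0..<n. d i (Suc l))"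
        proof -
          have "(\<Sum>l=Suc 0..<Suc n. d i l) = (\<Sum>l=0..<n. d i (Suc l))"
            by (rule sum.shift_bounds_Suc_ivl)
          then show ?thesis using gt_patterns_zero[OF d(1), of i n] step by simp
        qed
        ultimately have le: "(\<Sum>l=0..<n. d (Suc i) l) \<le> (\<Sum>l=0..<n. d i (Suc l))" by linarith
        show ?case
        proof (rule ccontr)
          assume ne: "d i (Suc l) \<noteq> d (Suc i) l"
          then have "l < n" using gt_patterns_zero[OF d(1)] by (metis add_leD2 not_le le_add2 le_SucI trans_le_add2)
          then have "(\<Sum>l=0..<n. d i (Suc l)) < (\<Sum>l=0..<n. d (Suc i) l)"
            using ne D(3) by (intro sum_strict_mono_ex1) (auto intro!: bexI[of _ l] simp: less_le)
          then show False using le by simp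
        qed
      qed
    qed (simp add: D(4))
    have "d i l = d 0 (i + l)" for i l
      by (induction i arbitrary: l) (simp_all add: shift[symmetric])
    then show ?thesis using D(1) by (simp add: fun_eq_iff)
  qed
  ultimately show ?thesis by blast
qed

lemma alternant_gt_poly:
  assumes lam: "antimono lam" "\<forall>i\<ge>n. lam i = 0"
  shows "alternant n (shifted n (\<lambda>_. 0)) * gt_poly n lam = alternant n (shifted n lam)"
proof -
  have "wt n (\<lambda>i l. lam (i + l)) i = lam i" for i
    using sum_telescope_nat[of "\<lambda>l. lam (i + l)" n] lam by (simp add: wt_def antimono_def)
  then show ?thesis
    using shifted_alternant_mult_gt_poly[of lam "\<lambda>_. 0" n] dominant_zero_patterns[OF lam] lam
    by (simp add: antimono_def)
qed

text \<open>Strict growth gives \<open>i \<le> w i\<close>, while both sides have the same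
  sum.\<close>

lemma strict_mono_permutes_id:
  assumes w: "w permutes {..<n::nat}" and mono: "\<And>i j. i < j \<Longrightarrow> j < n \<Longrightarrow> w i < w j"
  shows "w = id"
proof -
  have ge: "i \<le> w i" if "i < n" for i
    using that
  proof (induction i)
    case (Suc i)
    then show ?case using mono[of i "Suc i"] by simp
  qed simp
  have "(\<Sum>i<n. w i) = (\<Sum>i<n. i)"
    using sum.permute[OF w, of "\<lambda>i. i"] by (simp add: comp_def)
  then have "w i = i" if "i < n" for i
    using sum_mono_inv[of "\<lambda>i. i" "{..<n}" w i] ge that by simp
  then show ?thesis using permutes_not_in[OF w] by (auto simp: fun_eq_iff)
qed

text \<open>Only the identity rearranges a strictly decreasing sequence into a strictly decreasing
  one, so a single term of the alternant can meet the monomial of \<open>c\<close>. Such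
  coefficients tell alternants apart.\<close>

lemma lookup_alternant:
  assumes b: "\<And>i j. i < j \<Longrightarrow> j < n \<Longrightarrow> b j < b i" and c: "\<And>i j. i < j \<Longrightarrow> j < n \<Longrightarrow> c j < c i"
  shows "Poly_Mapping.lookup (alternant n b) (expo n c) = (if \<forall>i<n. b i = c i then 1 else 0)"
proof -
  have id: "w = id" if w: "w permutes {..<n}" and eq: "expo n (b \<circ> w) = expo n c" for w
  proof (rule strict_mono_permutes_id[OF w])
    fix i j assume ij: "i < j" "j < n"
    then have "b (w j) < b (w i)" using eq c[OF ij] by (simp add: expo_eq_iff)
    moreover have "w i < n" "w j < n" using permutes_in_image[OF w] ij by auto
    ultimately show "w i < w j" using b[of "w j" "w i"] by (metis less_asym linorder_neqE_nat)
  qed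
  have "Poly_Mapping.lookup (alternant n b) (expo n c) =
      (\<Sum>w | w permutes {..<n}. if w = id \<and> expo n b = expo n c then 1 else 0)"
    unfolding alternant_def lookup_sum
  proof (intro sum.cong refl)
    fix w assume "w \<in> {w. w permutes {..<n}}"
    then show "Poly_Mapping.lookup (Poly_Mapping.single (expo n (b \<circ> w)) (sign w)) (expo n c) =
        (if w = id \<and> expo n b = expo n c then 1 else 0)"
      using id[of w] by (cases "w = id") (auto simp: lookup_single when_def)
  qed
  also have "\<dots> = (if expo n b = expo n c then 1 else 0)"
    using sum.delta'[of "{w. w permutes {..<n}}" id] finite_permutations[of "{..<n}"] permutes_id
    by (simp)
  finally show ?thesis by (simp add: expo_eq_iff)
qed

lemma shifted_decreasing:
  assumes "antimono lam" "i < j" "j < n"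
  shows "shifted n lam j < shifted n lam i"
  using antimonoD[OF assms(1), of i j] assms(2,3) by (simp add: shifted_def)

lemma alternant_rho_nonzero: "alternant n (shifted n (\<lambda>_. 0)) \<noteq> 0"
proof -
  have "antimono (\<lambda>_::nat. 0::nat)" by (simp add: antimono_def)
  then have "Poly_Mapping.lookup (alternant n (shifted n (\<lambda>_. 0))) (expo n (shifted n (\<lambda>_. 0))) = 1"
    using lookup_alternant[of n "shifted n (\<lambda>_. 0)" "shifted n (\<lambda>_. 0)"] shifted_decreasing by simp
  then show ?thesis by auto
qed

text \<open>No entry exceeds \<open>lam 0\<close>, so the threshold \<open>lam 0\<close> keeps all
  columns.\<close>

lemma dominant_antimono:
  assumes d: "d \<in> gt_patterns n lam" and lam: "antimono lam" and dom: "dominant n mu d"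
  shows "antimono (\<lambda>i. mu i + wt n d i)"
proof -
  have "d i l \<le> lam 0" for i l
    using gt_patterns_le[OF d, of i l] antimonoD[OF lam, of 0 l] by simp
  then have "cut (lam 0) d = d" by (simp add: cut_def fun_eq_iff min.absorb1)
  then have "mu (Suc i) + wt n d (Suc i) \<le> mu i + wt n d i" for i
    using dom unfolding dominant_def by metis
  then show ?thesis by (simp add: antimono_iff_le_Suc)
qed

text \<open>Both sides agree after multiplication by the Vandermonde alternant, which is nonzero and
  can be cancelled. Dominance makes every \<open>mu + wt\<close> a partition, so each alternant that
  survives is again the Vandermonde times a Schur polynomial.\<close>

lemma gt_poly_mult:
  assumes lam: "antimono lam" and mu: "antimono mu" "\<forall>i\<ge>n. mu i = 0"
  shows "gt_poly n mu * gt_poly n lam =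
    (\<Sum>d | d \<in> gt_patterns n lam \<and> dominant n mu d. gt_poly n (\<lambda>i. mu i + wt n d i))"
proof -
  let ?a = "alternant n (shifted n (\<lambda>_. 0))"
  have "?a * (gt_poly n mu * gt_poly n lam) = alternant n (shifted n mu) * gt_poly n lam"
    using alternant_gt_poly[OF mu] by (simp add: mult.assoc[symmetric])
  also have "\<dots> = (\<Sum>d | d \<in> gt_patterns n lam \<and> dominant n mu d.
      ?a * gt_poly n (\<lambda>i. mu i + wt n d i))"
    unfolding shifted_alternant_mult_gt_poly[OF assms]
  proof (intro sum.cong refl alternant_gt_poly[symmetric])
    fix d assume "d \<in> {d. d \<in> gt_patterns n lam \<and> dominant n mu d}"
    then show "antimono (\<lambda>i. mu i + wt n d i)" "\<forall>i\<ge>n. mu i + wt n d i = 0"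
      using dominant_antimono[OF _ lam] mu(2) gt_patternsD(4)[of d n lam] by (auto simp: wt_def)
  qed
  finally show ?thesis
    using alternant_rho_nonzero by (simp add: sum_distrib_left[symmetric])
qed

section \<open>Semistandard tableaux as patterns\<close>

definition ssyt :: "nat \<Rightarrow> (nat \<Rightarrow> nat) \<Rightarrow> (nat \<times> nat \<Rightarrow> nat) set" where
  "ssyt n lam = {T \<in> semistandard lam. \<forall>c\<in>diagram lam. T c < n}"

text \<open>Label \<open>t\<close> of a tableau corresponds to row \<open>n - 1 - t\<close> of the pattern, whose top row
  is the full shape.\<close>
definition to_gt :: "nat \<Rightarrow> (nat \<Rightarrow> nat) \<Rightarrow> (nat \<times> nat \<Rightarrow> nat) \<Rightarrow> nat \<Rightarrow> nat \<Rightarrow> nat" where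
  "to_gt n lam T = (\<lambda>i l. card {j. j < lam l \<and> T (l, j) < n - i})"

text \<open>The entry of a cell is the number of rows of the pattern whose shape no longer contains
  that cell.\<close>

definition from_gt :: "nat \<Rightarrow> (nat \<Rightarrow> nat) \<Rightarrow> (nat \<Rightarrow> nat \<Rightarrow> nat) \<Rightarrow> nat \<times> nat \<Rightarrow> nat" where
  "from_gt n lam d = (\<lambda>(l, j). if j < lam l then card {i. i < n \<and> d i l \<le> j} else 0)"

lemma semistandardD:
  assumes "T \<in> semistandard lam"
  shows "lam l \<le> j \<Longrightarrow> T (l, j) = 0" "Suc j < lam l \<Longrightarrow> T (l, j) \<le> T (l, Suc j)"
    "j < lam (Suc l) \<Longrightarrow> T (l, j) < T (Suc l, j)"
  using assms by (auto simp: semistandard_def diagram_def)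

lemma semistandard_row_mono:
  assumes "T \<in> semistandard lam" "j \<le> j'" "j' < lam l"
  shows "T (l, j) \<le> T (l, j')"
  using assms(2,3)
proof (induction j' rule: dec_induct)
  case (step m)
  then show ?case using semistandardD(2)[OF assms(1), of m l] by simp
qed simp

text \<open>A count over a down-closed predicate is determined by the comparisons
  \<open>j < ...\<close>; interlacing and the inverse laws are then checked cell by cell.\<close>

lemma card_initial_segment:
  assumes "\<And>a b. a \<le> b \<Longrightarrow> P b \<Longrightarrow> P a" "\<not> P (m::nat)"
  shows "j < card {j. P j} \<longleftrightarrow> P j"
proof -
  define k where "k = (LEAST j. \<not> P j)"
  have "\<not> P k" unfolding k_def by (rule LeastI[of _ m]) fact
  moreover have "P j" if "j < k" for j
    using not_less_Least[OF that[unfolded k_def]] by simp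
  ultimately have *: "P j \<longleftrightarrow> j < k" for j using assms(1) by (metis not_le)
  show ?thesis by (simp add: *)
qed

lemma less_to_gt_iff:
  assumes "T \<in> semistandard lam"
  shows "j < to_gt n lam T i l \<longleftrightarrow> j < lam l \<and> T (l, j) < n - i"
  unfolding to_gt_def
  by (rule card_initial_segment[of _ "lam l"])
    (use semistandard_row_mono[OF assms] in \<open>auto intro: le_less_trans\<close>)

text \<open>The shapes shrink with \<open>i\<close>, so the rows missing a cell form a final segment
  of \<open>{..<n}\<close>. It has fewer than \<open>n - i\<close> members exactly if row
  \<open>i\<close> still contains the cell.\<close>

lemma less_card_iff_from_gt:
  assumes d: "d \<in> gt_patterns n lam" and "i < n"
  shows "card {i. i < n \<and> d i l \<le> j} < n - i \<longleftrightarrow> j < d i l"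
proof
  have anti: "d i' l \<le> d i l" if "i \<le> i'" for i i'
    by (rule lift_Suc_antimono_le[of "\<lambda>i. d i l"]) (use that gt_patternsD(2)[OF d] in simp_all)
  show "j < d i l" if "card {i. i < n \<and> d i l \<le> j} < n - i"
  proof (rule ccontr)
    assume "\<not> j < d i l"
    then have "d i' l \<le> j" if "i \<le> i'" for i' using anti[OF that] by simp
    then have "{i..<n} \<subseteq> {i. i < n \<and> d i l \<le> j}" by auto
    then have "card {i..<n} \<le> card {i. i < n \<and> d i l \<le> j}" by (intro card_mono) auto
    then show False using that by simp
  qed
  show "card {i. i < n \<and> d i l \<le> j} < n - i" if "j < d i l"
  proof -
    have "{i. i < n \<and> d i l \<le> j} \<subseteq> {Suc i..<n}"
    proof
      fix i' assume "i' \<in> {i. i < n \<and> d i l \<le> j}"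
      then show "i' \<in> {Suc i..<n}" using anti[of i' i] that by (cases "i' \<le> i") auto
    qed
    then have "card {i. i < n \<and> d i l \<le> j} \<le> card {Suc i..<n}" by (intro card_mono) auto
    then show ?thesis using \<open>i < n\<close> by simp
  qed
qed

lemma to_gt_in_gt_patterns:
  assumes "antimono lam" and T: "T \<in> ssyt n lam"
  shows "to_gt n lam T \<in> gt_patterns n lam"
proof -
  have ss: "T \<in> semistandard lam" and lt: "\<And>l j. j < lam l \<Longrightarrow> T (l, j) < n"
    using T by (auto simp: ssyt_def diagram_def)
  note iff = less_to_gt_iff[OF ss, of _ n]
  have leI: "a \<le> b" if "\<And>j. j < a \<Longrightarrow> j < b" for a b :: nat
    using that[of b] by (rule_tac ccontr) simp
  have "to_gt n lam T 0 l = lam l" for l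
    by (rule antisym; rule leI) (use lt in \<open>auto simp: iff\<close>)
  moreover have "to_gt n lam T (Suc i) l \<le> to_gt n lam T i l" for i l
    by (rule leI) (auto simp: iff)
  moreover have "to_gt n lam T i (Suc l) \<le> to_gt n lam T (Suc i) l" for i l
  proof (rule leI)
    fix j assume "j < to_gt n lam T i (Suc l)"
    then have "j < lam (Suc l)" "T (Suc l, j) < n - i" by (simp_all add: iff)
    then show "j < to_gt n lam T (Suc i) l"
      using semistandardD(3)[OF ss, of j l] antimonoD[OF assms(1), of l "Suc l"] by (simp add: iff)
  qed
  moreover have "to_gt n lam T i l = 0" if "n \<le> i" for i l
    using that by (simp add: to_gt_def)
  ultimately show ?thesis by (auto simp: gt_patterns_def)
qed

lemma from_gt_in_ssyt:
  assumes "antimono lam" and d: "d \<in> gt_patterns n lam"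
  shows "from_gt n lam d \<in> ssyt n lam"
proof -
  let ?c = "\<lambda>l j. card {i. i < n \<and> d i l \<le> j}"
  note D = gt_patternsD[OF d]
  have npos: "0 < n" if "j < lam l" for l j
    using that D(1) D(4)[of 0 l] by (cases n) auto
  have lt: "?c l j < n" if "j < lam l" for l j
    using less_card_iff_from_gt[OF d npos[OF that], where l = l and j = j] D(1) that by simp
  have row: "?c l j \<le> ?c l (Suc j)" for l j
    by (rule card_mono) auto
  have col: "?c l j < ?c (Suc l) j" if j: "j < lam (Suc l)" for l j
  proof -
    \<comment> \<open>Row \<open>i\<close> is the first one missing the cell
      \<open>(Suc l, j)\<close>, so row \<open>i - 1\<close> contains it. By interlacing row
      \<open>i\<close> contains \<open>(l, j)\<close>, whose entry is therefore smaller. The case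
      \<open>i = n\<close> would mean that even row \<open>n - 1\<close> reaches position
      \<open>Suc l\<close>.\<close>
    define i where "i = n - ?c (Suc l) j"
    have "?c (Suc l) j < n" by (rule lt[OF j])
    have ni: "n - i = ?c (Suc l) j" using \<open>?c (Suc l) j < n\<close> by (simp add: i_def)
    show ?thesis
    proof (cases "i = n")
      case True
      then have "?c (Suc l) j = 0" using ni by simp
      then have "{i. i < n \<and> d i (Suc l) \<le> j} = {}" by simp
      then have "\<not> d (n - 1) (Suc l) \<le> j" using npos[OF j] by auto
      moreover have "d (n - 1) (Suc l) = 0" by (rule gt_patterns_zero[OF d]) linarith
      ultimately show ?thesis by simp
    next
      case False
      then have "i < n" "0 < i" using \<open>?c (Suc l) j < n\<close> by (auto simp: i_def)
      have "?c (Suc l) j < n - (i - 1)" using ni \<open>0 < i\<close> \<open>i < n\<close> by simp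
      then have "j < d (i - 1) (Suc l)"
        using less_card_iff_from_gt[OF d, where i = "i - 1"] \<open>i < n\<close> by simp
      also have "d (i - 1) (Suc l) \<le> d i l" using D(3)[where i = "i - 1" and l = l] \<open>0 < i\<close> by simp
      finally have "?c l j < n - i" using less_card_iff_from_gt[OF d \<open>i < n\<close>] by simp
      then show ?thesis by (simp add: ni)
    qed
  qed
  show ?thesis
    using lt row col order.strict_trans2[OF _ antimonoD[OF assms(1) le_SucI[OF order_refl]]]
    by (auto simp: ssyt_def semistandard_def diagram_def from_gt_def)
qed

lemma bij_to_gt:
  assumes lam: "antimono lam"
  shows "bij_betw (to_gt n lam) (ssyt n lam) (gt_patterns n lam)"
proof (rule bij_betw_byWitness[where f' = "from_gt n lam"])
  show "\<forall>T\<in>ssyt n lam. from_gt n lam (to_gt n lam T) = T"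
  proof
    fix T assume T: "T \<in> ssyt n lam"
    then have ss: "T \<in> semistandard lam" and lt: "\<And>l j. j < lam l \<Longrightarrow> T (l, j) < n"
      by (auto simp: ssyt_def diagram_def)
    have "from_gt n lam (to_gt n lam T) (l, j) = T (l, j)" for l j
    proof (cases "j < lam l")
      case True
      have "{i. i < n \<and> to_gt n lam T i l \<le> j} = {n - T (l, j)..<n}"
        using True lt[OF True] by (auto simp: not_less[symmetric] less_to_gt_iff[OF ss])
      then show ?thesis using True lt[OF True] by (simp add: from_gt_def)
    qed (simp add: from_gt_def semistandardD(1)[OF ss])
    then show "from_gt n lam (to_gt n lam T) = T" by (auto simp: fun_eq_iff)
  qed
  show "\<forall>d\<in>gt_patterns n lam. to_gt n lam (from_gt n lam d) = d"
  proof
    fix d assume d: "d \<in> gt_patterns n lam"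
    have "to_gt n lam (from_gt n lam d) i l = d i l" for i l
    proof (cases "i < n")
      case True
      have "{j. j < lam l \<and> from_gt n lam d (l, j) < n - i} = {..<d i l}"
      proof (intro Set.set_eqI)
        fix j
        have "j < d i l \<longrightarrow> j < lam l" using gt_patterns_le[OF d, of i l] by simp
        then show "j \<in> {j. j < lam l \<and> from_gt n lam d (l, j) < n - i} \<longleftrightarrow> j \<in> {..<d i l}"
          using less_card_iff_from_gt[OF d True, of l j] by (auto simp only: from_gt_def mem_Collect_eq prod.case if_True lessThan_iff)
      qed
      then show ?thesis by (simp add: to_gt_def)
    qed (simp add: to_gt_def gt_patternsD(4)[OF d])
    then show "to_gt n lam (from_gt n lam d) = d" by (simp add: fun_eq_iff)
  qed
qed (use to_gt_in_gt_patterns[OF lam] from_gt_in_ssyt[OF lam] in auto)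

text \<open>Row \<open>n - 1 - t\<close> is the shape of the letters up to \<open>t\<close>, the
  next row that of the letters below \<open>t\<close>.\<close>

lemma content_to_gt:
  assumes "antimono lam" and T: "T \<in> ssyt n lam" and "t < n"
  shows "card {c \<in> diagram lam. T c = t} = wt n (to_gt n lam T) (n - 1 - t)"
proof -
  have lam0: "lam l = 0" if "n \<le> l" for l
    using gt_patterns_zero[OF to_gt_in_gt_patterns[OF assms(1) T], of 0 l]
      gt_patternsD(1)[OF to_gt_in_gt_patterns[OF assms(1) T]] that by simp
  have "{c \<in> diagram lam. T c = t} = (SIGMA l:{..<n}. {j. j < lam l \<and> T (l, j) = t})"
  proof -
    have "l < n" if "j < lam l" for l j using lam0[of l] that by (cases "l < n") auto
    then show ?thesis by (auto simp: diagram_def)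
  qed
  then have "card {c \<in> diagram lam. T c = t} = (\<Sum>l<n. card {j. j < lam l \<and> T (l, j) = t})"
    by simp
  moreover have "card {j. j < lam l \<and> T (l, j) = t} =
      to_gt n lam T (n - 1 - t) l - to_gt n lam T (Suc (n - 1 - t)) l" for l
  proof -
    let ?S = "\<lambda>t. {j. j < lam l \<and> T (l, j) < t}"
    have "{j. j < lam l \<and> T (l, j) = t} = ?S (Suc t) - ?S t" by auto
    then have "card {j. j < lam l \<and> T (l, j) = t} = card (?S (Suc t) - ?S t)" by (rule arg_cong)
    also have "\<dots> = card (?S (Suc t)) - card (?S t)" by (rule card_Diff_subset) auto
    also have "Suc t = n - (n - 1 - t)" using \<open>t < n\<close> by simp
    also have "?S t = ?S (n - Suc (n - 1 - t))" using \<open>t < n\<close> by simp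
    finally show ?thesis by (simp only: to_gt_def)
  qed
  ultimately show ?thesis by (simp add: wt_def)
qed

lemma finite_diagram:
  assumes "is_partition lam"
  shows "finite (diagram lam)"
proof -
  have "diagram lam \<subseteq> (SIGMA l:{l. lam l \<noteq> 0}. {..<lam l})" by (auto simp: diagram_def)
  then show ?thesis using assms by (rule_tac finite_subset) (auto simp: is_partition_def)
qed

lemma lookup_sum_single:
  assumes "finite A"
  shows "Poly_Mapping.lookup (\<Sum>d\<in>A. Poly_Mapping.single (e d) (1::int)) \<alpha> = int (card {d \<in> A. e d = \<alpha>})"
proof -
  have "Poly_Mapping.lookup (\<Sum>d\<in>A. Poly_Mapping.single (e d) (1::int)) \<alpha> =
      (\<Sum>d\<in>A. if e d = \<alpha> then 1 else 0)"
    by (simp only: lookup_sum lookup_single when_def)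
  also have "\<dots> = (\<Sum>d | d \<in> A \<and> e d = \<alpha>. 1)"
    by (rule sum.inter_filter[OF assms, symmetric])
  finally show ?thesis by simp
qed

lemma schur_eq_lookup_gt_poly:
  assumes lam: "is_partition lam" and \<alpha>: "\<forall>i\<ge>n. Poly_Mapping.lookup \<alpha> i = 0"
  shows "schur lam \<alpha> = Poly_Mapping.lookup (gt_poly n lam) \<alpha>"
proof -
  have anti: "antimono lam" using lam by (simp add: is_partition_def)
  \<comment> \<open>The reversal of the alphabet, extended by the identity;
    \<open>expo_wt_symmetric\<close> removes it at the end.\<close>
  define w where "w i = (if i < n then n - 1 - i else i)" for i
  have "bij_betw w {..<n} {..<n}"
    by (rule bij_betw_byWitness[where f' = w]) (auto simp: w_def)
  then have w: "w permutes {..<n}" by (rule bij_imp_permutes) (simp add: w_def)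
  let ?C = "\<lambda>T t. card {c \<in> diagram lam. T c = t}"
  have "{T \<in> semistandard lam. \<forall>t. ?C T t = Poly_Mapping.lookup \<alpha> t} =
      {T \<in> ssyt n lam. expo n (wt n (to_gt n lam T) \<circ> w) = \<alpha>}" (is "?L = ?R")
  proof (intro Set.set_eqI iffI)
    fix T assume T: "T \<in> ?L"
    have "T c < n" if c: "c \<in> diagram lam" for c
    proof (rule ccontr)
      assume "\<not> T c < n"
      then have "?C T (T c) = 0" using \<alpha> T by simp
      then show False using c finite_diagram[OF lam] by (cases c) auto
    qed
    then have "T \<in> ssyt n lam" using T by (simp add: ssyt_def)
    then show "T \<in> ?R" using T \<alpha> content_to_gt[OF anti \<open>T \<in> ssyt n lam\<close>]
      by (auto simp: poly_mapping_eq_iff fun_eq_iff lookup_expo w_def)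
  next
    fix T assume T: "T \<in> ?R"
    then have eq: "Poly_Mapping.lookup \<alpha> t = (if t < n then wt n (to_gt n lam T) (w t) else 0)" for t
      by (auto simp: lookup_expo)
    have "?C T t = Poly_Mapping.lookup \<alpha> t" for t
    proof (cases "t < n")
      case True
      then show ?thesis using content_to_gt[OF anti, of T n t] T by (simp add: eq w_def)
    next
      case False
      then have "{c \<in> diagram lam. T c = t} = {}" using T by (auto simp: ssyt_def)
      then have "?C T t = 0" by (simp only: card.empty)
      then show ?thesis using False by (simp add: eq)
    qed
    then show "T \<in> ?L" using T by (simp add: ssyt_def)
  qed
  moreover have "bij_betw (to_gt n lam) ?R {d \<in> gt_patterns n lam. expo n (wt n d \<circ> w) = \<alpha>}"
    using bij_to_gt[OF anti, of n] by (auto simp: bij_betw_def inj_on_def)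
  ultimately have "schur lam \<alpha> = int (card {d \<in> gt_patterns n lam. expo n (wt n d \<circ> w) = \<alpha>})"
    unfolding schur_def by (simp add: bij_betw_same_card)
  also have "\<dots> = Poly_Mapping.lookup (gt_poly n lam) \<alpha>"
    unfolding gt_poly_def expo_wt_symmetric[OF w, symmetric]
    by (rule lookup_sum_single[symmetric]) (rule finite_gt_patterns[OF anti])
  finally show ?thesis .
qed

section \<open>Schur series and the Littlewood-Richardson expansion\<close>

text \<open>A sum over an infinite set is 0 by convention, so finiteness is what gives
  \<open>mseries_mult\<close> its intended meaning.\<close>

lemma finite_splittings: "finite {(\<beta>, \<gamma>). \<beta> + \<gamma> = (\<alpha> :: nat \<Rightarrow>\<^sub>0 nat)}"
proof -
  let ?M = "\<Sum>i\<in>Poly_Mapping.keys \<alpha>. Poly_Mapping.lookup \<alpha> i"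
  let ?F = "{f. \<forall>i. (i \<in> Poly_Mapping.keys \<alpha> \<longrightarrow> f i \<in> {..?M}) \<and> (i \<notin> Poly_Mapping.keys \<alpha> \<longrightarrow> f i = 0)}"
  have "finite ?F" by (rule finite_set_of_finite_funs) simp_all
  moreover have image: "(\<lambda>p. Poly_Mapping.lookup (fst p)) ` {(\<beta>, \<gamma>). \<beta> + \<gamma> = \<alpha>} \<subseteq> ?F"
  proof clarsimp
    fix \<beta> \<gamma> :: "nat \<Rightarrow>\<^sub>0 nat" and i
    have "Poly_Mapping.lookup (\<beta> + \<gamma>) i \<le>
        (\<Sum>i\<in>Poly_Mapping.keys (\<beta> + \<gamma>). Poly_Mapping.lookup (\<beta> + \<gamma>) i)"
      if "i \<in> Poly_Mapping.keys (\<beta> + \<gamma>)"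
      using that by (intro member_le_sum) simp_all
    then show "(i \<in> Poly_Mapping.keys (\<beta> + \<gamma>) \<longrightarrow> Poly_Mapping.lookup \<beta> i \<le>
        (\<Sum>i\<in>Poly_Mapping.keys (\<beta> + \<gamma>). Poly_Mapping.lookup (\<beta> + \<gamma>) i)) \<and>
        (i \<notin> Poly_Mapping.keys (\<beta> + \<gamma>) \<longrightarrow> Poly_Mapping.lookup \<beta> i = 0)"
      by (auto simp: lookup_add in_keys_iff)
  qed
  moreover have "inj_on (\<lambda>p. Poly_Mapping.lookup (fst p)) {(\<beta>, \<gamma>). \<beta> + \<gamma> = \<alpha>}"
    by (auto simp: inj_on_def poly_mapping_eq_iff[symmetric])
  ultimately show ?thesis using finite_imageD[OF finite_subset[OF image]] by simp
qed

lemma lookup_mult_splittings: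
  fixes p q :: "(nat \<Rightarrow>\<^sub>0 nat) \<Rightarrow>\<^sub>0 int"
  shows "Poly_Mapping.lookup (p * q) \<alpha> =
    (\<Sum>(\<beta>, \<gamma>) | \<beta> + \<gamma> = \<alpha>. Poly_Mapping.lookup p \<beta> * Poly_Mapping.lookup q \<gamma>)"
proof -
  have "Poly_Mapping.lookup (p * q) \<alpha> =
      Sum_any (\<lambda>(\<beta>, \<gamma>). Poly_Mapping.lookup p \<beta> * Poly_Mapping.lookup q \<gamma> when \<alpha> = \<beta> + \<gamma>)"
    by (simp add: times_poly_mapping.rep_eq prod_fun_unfold_prod)
  also have "\<dots> = (\<Sum>(\<beta>, \<gamma>) | \<beta> + \<gamma> = \<alpha>.
      (Poly_Mapping.lookup p \<beta> * Poly_Mapping.lookup q \<gamma> when \<alpha> = \<beta> + \<gamma>))"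
    by (rule Sum_any.expand_superset[OF finite_splittings]) (auto simp: when_def split: if_splits)
  also have "\<dots> = (\<Sum>(\<beta>, \<gamma>) | \<beta> + \<gamma> = \<alpha>. Poly_Mapping.lookup p \<beta> * Poly_Mapping.lookup q \<gamma>)"
    by (rule sum.cong) (auto simp: when_def)
  finally show ?thesis .
qed

lemma splitting_support:
  assumes "\<forall>i\<ge>n. Poly_Mapping.lookup \<alpha> i = (0::nat)" "\<beta> + \<gamma> = \<alpha>"
  shows "\<forall>i\<ge>n. Poly_Mapping.lookup \<beta> i = 0" "\<forall>i\<ge>n. Poly_Mapping.lookup \<gamma> i = 0"
  using assms by (auto simp: lookup_add)

lemma mseries_mult_schur:
  assumes "is_partition lam" "is_partition mu" "\<forall>i\<ge>n. Poly_Mapping.lookup \<alpha> i = 0"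
  shows "mseries_mult (schur lam) (schur mu) \<alpha> = Poly_Mapping.lookup (gt_poly n lam * gt_poly n mu) \<alpha>"
  unfolding mseries_mult_def lookup_mult_splittings
  using splitting_support[OF assms(3)]
  by (intro sum.cong refl)
    (auto simp: schur_eq_lookup_gt_poly[OF assms(1), of n] schur_eq_lookup_gt_poly[OF assms(2), of n])

lemma poly_mapping_support_bound:
  fixes \<alpha> :: "nat \<Rightarrow>\<^sub>0 nat"
  obtains n where "\<forall>i\<ge>n. Poly_Mapping.lookup \<alpha> i = 0"
proof -
  have "finite {i. Poly_Mapping.lookup \<alpha> i \<noteq> 0}" by simp
  then obtain n where "\<forall>i\<in>{i. Poly_Mapping.lookup \<alpha> i \<noteq> 0}. i < n"
    using finite_nat_set_iff_bounded by blast
  then have "\<forall>i\<ge>n. Poly_Mapping.lookup \<alpha> i = 0" by (metis (mono_tags) mem_Collect_eq not_le)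
  then show thesis by (rule that)
qed

lemma is_partition_bound:
  assumes "is_partition lam"
  obtains n where "\<forall>i\<ge>n. lam i = 0"
proof -
  obtain n where "\<forall>i\<in>{i. lam i \<noteq> 0}. i < n"
    using assms finite_nat_set_iff_bounded unfolding is_partition_def by blast
  then have "\<forall>i\<ge>n. lam i = 0" by (metis (mono_tags) mem_Collect_eq not_le)
  then show thesis by (rule that)
qed

lemma lookup_alternant_mult_gt_poly:
  assumes nu: "is_partition nu" "\<forall>i\<ge>n. nu i = 0" and nu': "is_partition nu'" "\<forall>i\<ge>n. nu' i = 0"
  shows "Poly_Mapping.lookup (alternant n (shifted n (\<lambda>_. 0)) * gt_poly n nu) (expo n (shifted n nu')) =
    (if nu = nu' then 1 else 0)"
proof -
  have anti: "antimono nu" "antimono nu'" using nu nu' by (auto simp: is_partition_def)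
  have "(\<forall>i<n. shifted n nu i = shifted n nu' i) \<longleftrightarrow> nu = nu'"
    unfolding shifted_def fun_eq_iff using nu(2) nu'(2) by (metis add_right_cancel not_le)
  then show ?thesis
    using lookup_alternant[OF shifted_decreasing[OF anti(1)] shifted_decreasing[OF anti(2)]]
    by (simp add: alternant_gt_poly[OF anti(1) nu(2)])
qed

text \<open>Finitely many partitions fit into a common number \<open>n\<close> of variables.
  Multiplying the relation by the Vandermonde alternant and reading the coefficient at
  \<open>nu0\<close> plus \<rho> isolates \<open>e nu0\<close>.\<close>

lemma schur_independent:
  assumes "finite F" and part: "\<And>nu. nu \<in> F \<Longrightarrow> is_partition nu"
    and zero: "\<And>\<alpha>. (\<Sum>nu\<in>F. e nu * schur nu \<alpha>) = 0" and "nu0 \<in> F"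
  shows "e nu0 = 0"
proof -
  have "\<exists>n. \<forall>nu\<in>F. \<forall>i\<ge>n. nu i = 0"
    using \<open>finite F\<close> part
  proof (induction F)
    case (insert nu F)
    then obtain n where "\<forall>nu\<in>F. \<forall>i\<ge>n. nu i = 0" by auto
    moreover obtain m where "\<forall>i\<ge>m. nu i = 0"
      using is_partition_bound insert.prems[of nu] by blast
    ultimately have "\<forall>nu\<in>insert nu F. \<forall>i\<ge>max m n. nu i = 0" by auto
    then show ?case by blast
  qed simp
  then obtain n where n: "\<And>nu i. nu \<in> F \<Longrightarrow> n \<le> i \<Longrightarrow> nu i = 0" by blast
  let ?a = "alternant n (shifted n (\<lambda>_. 0))" and ?\<alpha> = "expo n (shifted n nu0)"
  have \<alpha>: "\<forall>i\<ge>n. Poly_Mapping.lookup ?\<alpha> i = 0" by (simp add: lookup_expo)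
  have "Poly_Mapping.lookup (?a * gt_poly n nu) ?\<alpha> =
      (\<Sum>(\<beta>, \<gamma>) | \<beta> + \<gamma> = ?\<alpha>. Poly_Mapping.lookup ?a \<beta> * schur nu \<gamma>)" if "nu \<in> F" for nu
    unfolding lookup_mult_splittings
    using splitting_support[OF \<alpha>] schur_eq_lookup_gt_poly[OF part[OF that], of n]
    by (intro sum.cong) auto
  then have "(\<Sum>nu\<in>F. e nu * Poly_Mapping.lookup (?a * gt_poly n nu) ?\<alpha>) =
      (\<Sum>nu\<in>F. \<Sum>(\<beta>, \<gamma>) | \<beta> + \<gamma> = ?\<alpha>. Poly_Mapping.lookup ?a \<beta> * (e nu * schur nu \<gamma>))"
    by (simp add: sum_distrib_left case_prod_unfold mult_ac)
  also have "\<dots> = (\<Sum>(\<beta>, \<gamma>) | \<beta> + \<gamma> = ?\<alpha>. \<Sum>nu\<in>F. Poly_Mapping.lookup ?a \<beta> * (e nu * schur nu \<gamma>))"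
    by (subst sum.swap) (simp add: case_prod_unfold)
  also have "\<dots> = 0"
    using zero by (simp add: sum_distrib_left[symmetric])
  also have "(\<Sum>nu\<in>F. e nu * Poly_Mapping.lookup (?a * gt_poly n nu) ?\<alpha>) =
      (\<Sum>nu\<in>F. if nu = nu0 then e nu else 0)"
    using n part \<open>nu0 \<in> F\<close> by (intro sum.cong refl) (simp add: lookup_alternant_mult_gt_poly)
  finally show ?thesis using \<open>finite F\<close> \<open>nu0 \<in> F\<close> by simp
qed

text \<open>This determines the \<open>THE\<close> in \<open>lr_coeff\<close>: the difference of two
  expansions is a finite linear relation between Schur functions.\<close>

lemma lr_expansion_unique:
  assumes "lr_expansion lam mu c" "lr_expansion lam mu c'"
  shows "c = c'"
proof
  fix nu0
  let ?F = "{nu. c nu \<noteq> 0} \<union> {nu. c' nu \<noteq> 0}"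
  note c = assms[unfolded lr_expansion_def]
  have fin: "finite ?F" using c by simp
  have "(\<Sum>nu\<in>?F. c nu * schur nu \<alpha>) = (\<Sum>nu\<in>?F. c' nu * schur nu \<alpha>)" for \<alpha>
  proof -
    have "(\<Sum>nu\<in>?F. c nu * schur nu \<alpha>) = (\<Sum>nu | c nu \<noteq> 0. c nu * schur nu \<alpha>)"
      using fin by (intro sum.mono_neutral_right) auto
    moreover have "(\<Sum>nu\<in>?F. c' nu * schur nu \<alpha>) = (\<Sum>nu | c' nu \<noteq> 0. c' nu * schur nu \<alpha>)"
      using fin by (intro sum.mono_neutral_right) auto
    ultimately show ?thesis using c by metis
  qed
  then have "(\<Sum>nu\<in>?F. (c nu - c' nu) * schur nu \<alpha>) = 0" for \<alpha>
    by (simp add: left_diff_distrib sum_subtractf)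
  moreover have "is_partition nu" if "nu \<in> ?F" for nu using c that by blast
  ultimately have "c nu0 - c' nu0 = 0" if "nu0 \<in> ?F"
    using schur_independent[OF fin, of "\<lambda>nu. c nu - c' nu"] that by blast
  then show "c nu0 = c' nu0" by (cases "nu0 \<in> ?F") auto
qed

section \<open>Independence of the number of variables\<close>

definition lr_patterns ::
    "nat \<Rightarrow> (nat \<Rightarrow> nat) \<Rightarrow> (nat \<Rightarrow> nat) \<Rightarrow> (nat \<Rightarrow> nat) \<Rightarrow> (nat \<Rightarrow> nat \<Rightarrow> nat) set" where
  "lr_patterns n lam mu nu =
     {d \<in> gt_patterns n lam. dominant n mu d \<and> (\<lambda>i. mu i + wt n d i) = nu}"

lemma wt_restrict:
  assumes "d \<in> gt_patterns k lam" "k \<le> n"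
  shows "wt n d = wt k d" "wt n (cut J d) = wt k (cut J d)"
proof -
  have zero: "d i l = 0" if "l \<in> {..<n} - {..<k}" for i l
    using gt_patterns_zero[OF assms(1)] that by simp
  show "wt n d = wt k d" "wt n (cut J d) = wt k (cut J d)"
    unfolding wt_def cut_def fun_eq_iff
    using assms(2) by (intro allI sum.mono_neutral_right ballI; simp add: zero)+
qed

text \<open>The weight of row \<open>i\<close> is at most \<open>nu i\<close>, hence 0 from
  \<open>k\<close> on. So all rows from \<open>k\<close> to \<open>n\<close> agree, and row
  \<open>n\<close> is zero.\<close>

lemma lr_patterns_restrict:
  assumes "k \<le> n" and nu: "\<forall>i\<ge>k. nu i = 0"
  shows "lr_patterns n lam mu nu = lr_patterns k lam mu nu"
proof -
  have "d \<in> gt_patterns k lam" if d: "d \<in> lr_patterns n lam mu nu" for d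
  proof -
    have gt: "d \<in> gt_patterns n lam" and "wt n d i \<le> nu i" for i
      using d by (auto simp: lr_patterns_def)
    note D = gt_patternsD[OF gt]
    have eq_Suc: "d i l = d (Suc i) l" if "k \<le> i" for i l
    proof (cases "l < n")
      case True
      have "wt n d i = 0" using \<open>wt n d i \<le> nu i\<close> nu that by simp
      then have "d i l - d (Suc i) l = 0" using True by (simp add: wt_def)
      then show ?thesis using D(2)[of i l] by simp
    next
      case False
      then show ?thesis using gt_patterns_zero[OF gt] by simp
    qed
    have "d i l = 0" if "k \<le> i" for i l
    proof (cases "i \<le> n")
      case True
      then show ?thesis using that
      proof (induction rule: inc_induct)
        case (step m)
        then show ?case using eq_Suc[of m l] by simp
      qed (simp add: D(4))
    qed (simp add: D(4))
    then show ?thesis using D(1-3) by (simp add: gt_patterns_def)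
  qed
  moreover have "d \<in> gt_patterns n lam" if "d \<in> gt_patterns k lam" for d
    using that \<open>k \<le> n\<close> by (auto simp: gt_patterns_def)
  moreover have "d \<in> lr_patterns n lam mu nu \<longleftrightarrow> d \<in> lr_patterns k lam mu nu"
    if "d \<in> gt_patterns k lam" "d \<in> gt_patterns n lam" for d
    using that wt_restrict[OF that(1) \<open>k \<le> n\<close>] by (simp add: lr_patterns_def dominant_def)
  moreover have "d \<in> gt_patterns k lam" if "d \<in> lr_patterns k lam mu nu" for d
    using that by (simp add: lr_patterns_def)
  ultimately show ?thesis by blast
qed

lemma lr_patterns_partition:
  assumes "d \<in> lr_patterns n lam mu nu" "antimono lam" "\<forall>i\<ge>n. mu i = 0"
  shows "antimono nu" "\<forall>i\<ge>n. nu i = 0"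
proof -
  have d: "d \<in> gt_patterns n lam" "dominant n mu d" "nu = (\<lambda>i. mu i + wt n d i)"
    using assms(1) by (auto simp: lr_patterns_def)
  show "antimono nu" using dominant_antimono[OF d(1) assms(2) d(2)] d(3) by simp
  show "\<forall>i\<ge>n. nu i = 0" using assms(3) gt_patternsD(4)[OF d(1)] d(3) by (simp add: wt_def)
qed

lemma sum_wt_plus_row:
  assumes "d \<in> gt_patterns n lam"
  shows "(\<Sum>i<m. wt n d i) + (\<Sum>l<n. d m l) = (\<Sum>l<n. lam l)"
proof (induction m)
  case 0
  then show ?case using gt_patternsD(1)[OF assms] by simp
next
  case (Suc m)
  then show ?case using wt_sum[of d m n] gt_patternsD(2)[OF assms] by simp
qed

lemma lr_patterns_size:
  assumes "d \<in> lr_patterns n lam mu nu"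
  shows "(\<Sum>i<n. nu i) = (\<Sum>i<n. mu i) + (\<Sum>i<n. lam i)"
proof -
  have d: "d \<in> gt_patterns n lam" "nu = (\<lambda>i. mu i + wt n d i)"
    using assms by (auto simp: lr_patterns_def)
  have "(\<Sum>i<n. wt n d i) = (\<Sum>l<n. lam l)"
    using sum_wt_plus_row[OF d(1), of n] gt_patternsD(4)[OF d(1)] by simp
  then show ?thesis by (simp add: d(2) sum.distrib)
qed

text \<open>\<open>nu\<close> is a partition of size at most \<open>N\<close>, so it has at most
  \<open>N\<close> parts.\<close>

lemma lr_patterns_bounded:
  assumes "antimono lam" "\<forall>i\<ge>n. mu i = 0" and d: "d \<in> lr_patterns n lam mu nu"
    and N: "(\<Sum>i<n. mu i) + (\<Sum>i<n. lam i) \<le> N" and "N \<le> i"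
  shows "nu i = 0"
proof (rule ccontr)
  assume "nu i \<noteq> 0"
  note nu = lr_patterns_partition[OF d assms(1,2)]
  have "i < n" using nu(2) \<open>nu i \<noteq> 0\<close> not_less by blast
  have "1 \<le> nu j" if "j \<le> i" for j
    using antimonoD[OF nu(1) that] \<open>nu i \<noteq> 0\<close> by simp
  then have "(\<Sum>j<Suc i. 1) \<le> (\<Sum>j<Suc i. nu j)" by (intro sum_mono) auto
  also have "\<dots> \<le> (\<Sum>j<n. nu j)" using \<open>i < n\<close> by (intro sum_mono2) auto
  also have "\<dots> \<le> N" using lr_patterns_size[OF d] N by simp
  finally show False using \<open>N \<le> i\<close> by simp
qed

text \<open>The coefficient at \<alpha> is computed in \<open>n\<close> variables, where
  \<open>n\<close> depends on \<alpha>. Grouping the product by \<open>nu\<close> gives fibres of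
  patterns for \<open>n\<close>; since each \<open>nu\<close> that occurs has at most
  \<open>N\<close> parts, these are the fibres for the fixed \<open>N\<close>.\<close>

lemma lr_expansion_lr_patterns:
  assumes lam: "is_partition lam" and mu: "is_partition mu"
    and muN: "\<forall>i\<ge>N. mu i = 0" and N: "\<And>n. (\<Sum>i<n. mu i) + (\<Sum>i<n. lam i) \<le> N"
  shows "lr_expansion lam mu (\<lambda>nu. int (card (lr_patterns N lam mu nu)))"
proof -
  have anti: "antimono lam" "antimono mu" using lam mu by (auto simp: is_partition_def)
  let ?c = "\<lambda>nu. int (card (lr_patterns N lam mu nu))"
  have part: "is_partition nu" if ne: "lr_patterns N lam mu nu \<noteq> {}" for nu
  proof -
    obtain d where "d \<in> lr_patterns N lam mu nu" using ne by blast
    note nu = lr_patterns_partition[OF this anti(1) muN]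
    have "i < N" if "nu i \<noteq> 0" for i using nu(2) that not_less by blast
    then have "finite {i. nu i \<noteq> 0}" by (auto intro: finite_subset[of _ "{..<N}"])
    then show ?thesis using nu(1) by (simp add: is_partition_def)
  qed
  have c0: "?c nu \<noteq> 0 \<Longrightarrow> lr_patterns N lam mu nu \<noteq> {}" for nu by auto
  have "{nu. ?c nu \<noteq> 0} \<subseteq> (\<lambda>d i. mu i + wt N d i) ` gt_patterns N lam"
    using c0 by (auto simp: lr_patterns_def)
  then have fin: "finite {nu. ?c nu \<noteq> 0}"
    by (rule finite_subset) (simp add: finite_gt_patterns[OF anti(1)])
  have "mseries_mult (schur lam) (schur mu) \<alpha> = (\<Sum>nu | ?c nu \<noteq> 0. ?c nu * schur nu \<alpha>)" for \<alpha>
  proof -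
    obtain m where m: "\<forall>i\<ge>m. Poly_Mapping.lookup \<alpha> i = 0" by (rule poly_mapping_support_bound)
    define n where "n = max m N"
    have \<alpha>: "\<forall>i\<ge>n. Poly_Mapping.lookup \<alpha> i = 0" and "N \<le> n" and mun: "\<forall>i\<ge>n. mu i = 0"
      using m muN by (auto simp: n_def)
    let ?D = "{d. d \<in> gt_patterns n lam \<and> dominant n mu d}" and ?f = "\<lambda>d i. mu i + wt n d i"
    have finD: "finite ?D" using finite_gt_patterns[OF anti(1), of n] by simp
    have fib: "{d \<in> ?D. ?f d = nu} = lr_patterns N lam mu nu" if nu: "nu \<in> ?f ` ?D" for nu
    proof -
      have eq: "{d \<in> ?D. ?f d = nu} = lr_patterns n lam mu nu" by (auto simp: lr_patterns_def)
      have "{d \<in> ?D. ?f d = nu} \<noteq> {}" using nu by blast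
      then obtain d where "d \<in> lr_patterns n lam mu nu" unfolding eq by blast
      then have "\<forall>i\<ge>N. nu i = 0" using lr_patterns_bounded[OF anti(1) mun _ N] by blast
      then show ?thesis using lr_patterns_restrict[OF \<open>N \<le> n\<close>] eq by simp
    qed
    have "mseries_mult (schur lam) (schur mu) \<alpha> = Poly_Mapping.lookup (gt_poly n mu * gt_poly n lam) \<alpha>"
      using mseries_mult_schur[OF lam mu \<alpha>] by (simp add: mult.commute)
    also have "\<dots> = (\<Sum>d\<in>?D. Poly_Mapping.lookup (gt_poly n (?f d)) \<alpha>)"
      by (simp only: gt_poly_mult[OF anti mun] lookup_sum)
    also have "\<dots> = (\<Sum>nu\<in>?f ` ?D. \<Sum>d | d \<in> ?D \<and> ?f d = nu. Poly_Mapping.lookup (gt_poly n (?f d)) \<alpha>)"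
      by (rule sum.image_gen[OF finD])
    also have "\<dots> = (\<Sum>nu\<in>?f ` ?D. ?c nu * schur nu \<alpha>)"
    proof (rule sum.cong[OF refl])
      fix nu assume nu: "nu \<in> ?f ` ?D"
      then have "{d \<in> ?D. ?f d = nu} \<noteq> {}" by blast
      then have "is_partition nu" unfolding fib[OF nu] by (rule part)
      have "(\<Sum>d | d \<in> ?D \<and> ?f d = nu. Poly_Mapping.lookup (gt_poly n (?f d)) \<alpha>) =
          (\<Sum>d | d \<in> ?D \<and> ?f d = nu. schur nu \<alpha>)"
        by (rule sum.cong) (auto simp: schur_eq_lookup_gt_poly[OF \<open>is_partition nu\<close> \<alpha>])
      also have "\<dots> = ?c nu * schur nu \<alpha>" by (simp only: sum_constant fib[OF nu])
      finally show "(\<Sum>d | d \<in> ?D \<and> ?f d = nu. Poly_Mapping.lookup (gt_poly n (?f d)) \<alpha>) = ?c nu * schur nu \<alpha>" .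
    qed
    also have "\<dots> = (\<Sum>nu | ?c nu \<noteq> 0. ?c nu * schur nu \<alpha>)"
    proof (rule sum.mono_neutral_cong_right)
      show "{nu. ?c nu \<noteq> 0} \<subseteq> ?f ` ?D"
      proof
        fix nu assume "nu \<in> {nu. ?c nu \<noteq> 0}"
        then obtain d where d: "d \<in> lr_patterns N lam mu nu" using c0[of nu] by blast
        then have "d \<in> lr_patterns n lam mu nu"
          using lr_patterns_restrict[OF \<open>N \<le> n\<close>] lr_patterns_partition(2)[OF d anti(1) muN] by simp
        then show "nu \<in> ?f ` ?D" by (auto simp: lr_patterns_def)
      qed
    qed (use finD in auto)
    finally show ?thesis .
  qed
  then show ?thesis using part c0 fin by (auto simp: lr_expansion_def)
qed

lemma lr_coeff_eq_card:
  assumes lam: "is_partition lam" and mu: "is_partition mu" and nu: "\<forall>i\<ge>k. nu i = 0"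
  shows "lr_coeff lam mu nu = int (card (lr_patterns k lam mu nu))"
proof -
  obtain a where a: "\<forall>i\<ge>a. lam i = 0" using is_partition_bound[OF lam] .
  obtain b where b: "\<forall>i\<ge>b. mu i = 0" using is_partition_bound[OF mu] .
  \<comment> \<open>The two sizes bound the number of parts of every partition that occurs;
    \<open>b\<close> makes \<open>mu\<close> vanish from \<open>N\<close> on, and \<open>k\<close>
    gives \<open>k \<le> N\<close>.\<close>
  define N where "N = (\<Sum>i<b. mu i) + (\<Sum>i<a. lam i) + b + k"
  have le: "(\<Sum>i<n. f i) \<le> (\<Sum>i<m. f i)" if "\<forall>i\<ge>m. f i = 0" for f :: "nat \<Rightarrow> nat" and m n
  proof -
    have "(\<Sum>i<n. f i) = (\<Sum>i\<in>{..<n} \<inter> {..<m}. f i)"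
      using that by (intro sum.mono_neutral_right ballI) auto
    also have "\<dots> \<le> (\<Sum>i<m. f i)" by (intro sum_mono2) auto
    finally show ?thesis .
  qed
  have "lr_expansion lam mu (\<lambda>nu. int (card (lr_patterns N lam mu nu)))"
    using lam mu
  proof (rule lr_expansion_lr_patterns)
    show "\<forall>i\<ge>N. mu i = 0" using b by (simp add: N_def)
    show "(\<Sum>i<n. mu i) + (\<Sum>i<n. lam i) \<le> N" for n
      using le[OF a, of n] le[OF b, of n] by (simp add: N_def)
  qed
  then have "(THE c. lr_expansion lam mu c) = (\<lambda>nu. int (card (lr_patterns N lam mu nu)))"
    using lr_expansion_unique by blast
  moreover have "lr_patterns N lam mu nu = lr_patterns k lam mu nu"
    using nu by (intro lr_patterns_restrict) (simp_all add: N_def)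
  ultimately show ?thesis by (simp add: lr_coeff_def)
qed

section \<open>The linear system of the hive inequalities\<close>

lemma distinct_concat_pairs:
  assumes "distinct xs" "\<And>x. distinct (f x)"
  shows "distinct (concat (map (\<lambda>x. map (Pair x) (f x)) xs))"
  using assms by (induction xs) (auto simp: distinct_map inj_on_def)

lemma interior_alt: "interior k = concat (map (\<lambda>i. map (Pair i) [1..<k - i]) [1..<k])"
  by (simp add: interior_def)

lemma distinct_interior: "distinct (interior k)"
  unfolding interior_alt by (rule distinct_concat_pairs) simp_all

lemma set_interior: "set (interior k) = {(i, j). 1 \<le> i \<and> 1 \<le> j \<and> i + j < k}"
  by (force simp: interior_alt image_iff)

lemma hive_inequalities_ball:
  "(\<forall>R\<in>set (hive_inequalities k). P R) \<longleftrightarrow> (\<forall>i j. i + j + 2 \<le> k \<longrightarrow>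
     P (((i + 1, j), (i, j + 1)), ((i, j), (i + 1, j + 1))) \<and>
     P (((i + 1, j), (i + 1, j + 1)), ((i + 2, j), (i, j + 1))) \<and>
     P (((i, j + 1), (i + 1, j + 1)), ((i + 1, j), (i, j + 2))))"
  (is "_ \<longleftrightarrow> (\<forall>i j. _ \<longrightarrow> ?Q i j)")
proof -
  have "(\<forall>R\<in>set (hive_inequalities k). P R) \<longleftrightarrow> (\<forall>i\<in>{0..<k}. \<forall>j\<in>{0..<k - 1 - i}. ?Q i j)"
    by (simp add: hive_inequalities_def)
  moreover have "i \<in> {0..<k} \<and> j \<in> {0..<k - 1 - i} \<longleftrightarrow> i + j + 2 \<le> k" for i j by auto
  ultimately show ?thesis by (metis (no_types, lifting))
qed

lemma sum_unit_fun:
  assumes "finite A" "A \<subseteq> B" "finite B"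
  shows "(\<Sum>t\<in>B. l t * (\<Sum>s\<in>A. unit_fun t s)) = (\<Sum>s\<in>A. l s)"
proof -
  have "(\<Sum>s\<in>A. unit_fun t s) = (if t \<in> A then 1 else 0)" for t
    using assms(1) by (simp add: unit_fun_def)
  then have "(\<Sum>t\<in>B. l t * (\<Sum>s\<in>A. unit_fun t s)) = (\<Sum>t\<in>B. if t \<in> A then l t else 0)"
    by (intro sum.cong) auto
  also have "\<dots> = (\<Sum>s\<in>A. l s)"
    using assms by (simp add: sum.If_cases Int_absorb1)
  finally show ?thesis .
qed

text \<open>Which branch of \<open>hive\<close> applies depends only on the position, and each
  branch is a partial sum or a single coordinate. This justifies reading the matrix entries off at
  unit vectors.\<close>

lemma hive_linear:
  assumes "fst p + snd p \<le> k"
  shows "hive k l m n a p =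
    (\<Sum>v\<in>set (interior k). a v * hive k (\<lambda>_. 0) (\<lambda>_. 0) (\<lambda>_. 0) (unit_fun v) p) +
    (\<Sum>t<k. l t * hive k (unit_fun t) (\<lambda>_. 0) (\<lambda>_. 0) (\<lambda>_. 0) p) +
    (\<Sum>t<k. m t * hive k (\<lambda>_. 0) (unit_fun t) (\<lambda>_. 0) (\<lambda>_. 0) p) +
    (\<Sum>t<k. n t * hive k (\<lambda>_. 0) (\<lambda>_. 0) (unit_fun t) (\<lambda>_. 0) p)"
proof -
  obtain i j where p: "p = (i, j)" and ij: "i + j \<le> k" using assms by (cases p) simp
  have u: "(\<Sum>t<k. f t * (\<Sum>s<b. unit_fun t s)) = (\<Sum>s<b. f s)" if "b \<le> k" for f :: "nat \<Rightarrow> int" and b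
    using that by (intro sum_unit_fun) auto
  show ?thesis
  proof (cases "i = 0 \<or> j = 0 \<or> i + j = k")
    case True
    then show ?thesis using ij unfolding p hive_def by (auto simp: u)
  next
    case False
    then have "p \<in> set (interior k)" using ij by (simp add: p set_interior)
    then have "(\<Sum>v\<in>set (interior k). a v * unit_fun v p) = a p"
      by (simp add: unit_fun_def if_distrib[of "(*) _"] cong: if_cong)
    then show ?thesis using False unfolding p hive_def by simp
  qed
qed

lemma rhombus_form_hive:
  assumes "R \<in> set (hive_inequalities k)"
  shows "rhombus_form R (hive k l m n a) = (\<Sum>v\<in>set (interior k). b_coeff k R v * a v) -
    ((\<Sum>t<k. c_coeff k R t * l t) + (\<Sum>t<k. d_coeff k R t * m t) + (\<Sum>t<k. e_coeff k R t * n t))"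
proof -
  obtain p q r s where R: "R = ((p, q), (r, s))" by (metis surj_pair)
  have "\<forall>R\<in>set (hive_inequalities k). case R of ((p, q), (r, s)) \<Rightarrow>
      \<forall>x\<in>{p, q, r, s}. fst x + snd x \<le> k"
    unfolding hive_inequalities_ball by auto
  then have "fst x + snd x \<le> k" if "x \<in> {p, q, r, s}" for x using assms R that by fastforce
  then have *: "fst p + snd p \<le> k" "fst q + snd q \<le> k" "fst r + snd r \<le> k" "fst s + snd s \<le> k"
    by auto
  show ?thesis
    unfolding R rhombus_form_def b_coeff_def c_coeff_def d_coeff_def e_coeff_def prod.case
    unfolding *[THEN hive_linear[of _ _ l m n a]]
    by (simp add: algebra_simps sum.distrib sum_subtractf sum_negf)
qed

text \<open>The lower blocks have no rows, so they only append an empty vector.\<close>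

lemma append_cols_mult_vec:
  assumes "A \<in> carrier_mat n p" "B \<in> carrier_mat n q" "u \<in> carrier_vec p" "w \<in> carrier_vec q"
  shows "append_cols A B *\<^sub>v (u @\<^sub>v w) = A *\<^sub>v u + B *\<^sub>v w"
proof -
  have "append_cols A B *\<^sub>v (u @\<^sub>v w) =
      (A *\<^sub>v u + B *\<^sub>v w) @\<^sub>v (0\<^sub>m 0 p *\<^sub>v u + 0\<^sub>m 0 q *\<^sub>v w)"
    unfolding append_cols_def using assms by (subst four_block_mat_mult_vec) auto
  also have "\<dots> = A *\<^sub>v u + B *\<^sub>v w"
    using assms by (intro eq_vecI) auto
  finally show ?thesis .
qed

lemma append_cols_carrier:
  assumes "A \<in> carrier_mat n p" "B \<in> carrier_mat n q"
  shows "append_cols A B \<in> carrier_mat n (p + q)"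
  using assms by (intro carrier_matI) (simp_all add: append_cols_def)

lemma B_mat_mult:
  assumes "m < length (hive_inequalities k)"
  defines "R \<equiv> hive_inequalities k ! m"
  shows "(B_mat k *\<^sub>v (part_vec k lam @\<^sub>v part_vec k mu @\<^sub>v part_vec k nu)) $ m =
    (\<Sum>t<k. c_coeff k R t * int (lam t)) + (\<Sum>t<k. d_coeff k R t * int (mu t)) +
    (\<Sum>t<k. e_coeff k R t * int (nu t))"
proof -
  let ?n = "length (hive_inequalities k)"
  let ?M = "\<lambda>f. mat ?n k (\<lambda>(m, t). f k (hive_inequalities k ! m) t) :: int mat"
  have M: "?M f \<in> carrier_mat ?n k" for f by simp
  have v: "part_vec k lam \<in> carrier_vec k" for lam by (simp add: part_vec_def)
  have vv: "part_vec k mu @\<^sub>v part_vec k nu \<in> carrier_vec (k + k)" using v by simp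
  have entry: "(?M f *\<^sub>v part_vec k lam) $ m = (\<Sum>t<k. f k R t * int (lam t))" for f lam
    using assms(1) by (simp add: scalar_prod_def part_vec_def R_def atLeast0LessThan)
  show ?thesis
    unfolding B_mat_def Let_def append_cols_mult_vec[OF M append_cols_carrier[OF M M] v vv]
      append_cols_mult_vec[OF M M v v]
    using assms(1) by (simp add: entry del: index_mult_mat_vec)
qed

lemma E_mat_mult:
  assumes "m < length (hive_inequalities k)"
    and u: "u \<in> carrier_vec (length (interior k))" and w: "w \<in> carrier_vec (length (hive_inequalities k))"
  defines "R \<equiv> hive_inequalities k ! m"
  shows "(E_mat k *\<^sub>v (u @\<^sub>v w)) $ m = (\<Sum>l<length (interior k). b_coeff k R (interior k ! l) * u $ l) + w $ m"
proof -
  let ?n = "length (hive_inequalities k)" and ?p = "length (interior k)"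
  let ?M = "mat ?n ?p (\<lambda>(m, l). b_coeff k (hive_inequalities k ! m) (interior k ! l))"
  have M: "?M \<in> carrier_mat ?n ?p" by simp
  have "E_mat k *\<^sub>v (u @\<^sub>v w) = ?M *\<^sub>v u + 1\<^sub>m ?n *\<^sub>v w"
    unfolding E_mat_def Let_def by (rule append_cols_mult_vec[OF M one_carrier_mat u w])
  also have "\<dots> $ m = (?M *\<^sub>v u) $ m + w $ m"
    using assms(1) w by (simp del: index_mult_mat_vec)
  also have "(?M *\<^sub>v u) $ m = (\<Sum>l<?p. b_coeff k R (interior k ! l) * u $ l)"
    using assms(1) u by (simp add: scalar_prod_def R_def atLeast0LessThan)
  finally show ?thesis .
qed

text \<open>Interior entries are natural numbers because \<open>vector_partition\<close> counts
  natural vectors; the value 0 elsewhere lets the interior coordinates determine the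
  function.\<close>

definition hives :: "nat \<Rightarrow> (nat \<Rightarrow> nat) \<Rightarrow> (nat \<Rightarrow> nat) \<Rightarrow> (nat \<Rightarrow> nat) \<Rightarrow> (nat \<times> nat \<Rightarrow> nat) set" where
  "hives k lam mu nu = {a. (\<forall>v. v \<notin> set (interior k) \<longrightarrow> a v = 0) \<and>
     (\<forall>R\<in>set (hive_inequalities k).
        rhombus_form R (hive k (int \<circ> lam) (int \<circ> mu) (int \<circ> nu) (int \<circ> a)) \<le> 0)}"

text \<open>Each equation forces its slack variable to be minus the rhombus form, and this is a
  natural number exactly if the inequality holds. A solution is thus the same as its interior
  part.\<close>

lemma vector_partition_eq_card_hives:
  "vector_partition (E_mat k) (B_mat k *\<^sub>v (part_vec k lam @\<^sub>v part_vec k mu @\<^sub>v part_vec k nu)) =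
     card (hives k lam mu nu)"
proof -
  let ?V = "interior k" and ?I = "hive_inequalities k"
  let ?p = "length ?V" and ?n = "length ?I"
  let ?b = "B_mat k *\<^sub>v (part_vec k lam @\<^sub>v part_vec k mu @\<^sub>v part_vec k nu)"
  let ?r = "\<lambda>a m. rhombus_form (?I ! m) (hive k (int \<circ> lam) (int \<circ> mu) (int \<circ> nu) (int \<circ> a))"
  define sol where "sol = {x :: nat vec. x \<in> carrier_vec (dim_col (E_mat k)) \<and> E_mat k *\<^sub>v map_vec int x = ?b}"
  define f where "f a = vec ?p (\<lambda>l. a (?V ! l)) @\<^sub>v vec ?n (\<lambda>m. nat (- ?r a m))" for a
  have dims: "dim_col (E_mat k) = ?p + ?n" "dim_row (E_mat k) = ?n" "dim_row (B_mat k) = ?n"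
    by (simp_all add: E_mat_def B_mat_def Let_def append_cols_def)
  have r: "?r a m = (\<Sum>l<?p. b_coeff k (?I ! m) (?V ! l) * int (a (?V ! l))) - ?b $ m"
    if "m < ?n" for a m
  proof -
    have "(\<Sum>v\<in>set ?V. b_coeff k (?I ! m) v * (int \<circ> a) v) =
        (\<Sum>l<?p. b_coeff k (?I ! m) (?V ! l) * int (a (?V ! l)))"
      using sum.reindex_bij_betw[OF bij_betw_nth[OF distinct_interior refl refl],
          of "\<lambda>v. b_coeff k (?I ! m) v * (int \<circ> a) v" k] by simp
    then show ?thesis
      using rhombus_form_hive[of "?I ! m" k] that by (simp add: B_mat_mult[OF that])
  qed
  have iff: "u @\<^sub>v w \<in> sol \<longleftrightarrow> (\<forall>m<?n. int (w $ m) = - ?r a m)"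
    if u: "u = vec ?p (\<lambda>l. a (?V ! l))" and w: "w \<in> carrier_vec ?n" for a u w
  proof -
    have "map_vec int (u @\<^sub>v w) = map_vec int u @\<^sub>v map_vec int w"
      by (intro eq_vecI) auto
    then have "u @\<^sub>v w \<in> sol \<longleftrightarrow> E_mat k *\<^sub>v (map_vec int u @\<^sub>v map_vec int w) = ?b"
      using u w by (simp add: sol_def dims)
    also have "\<dots> \<longleftrightarrow> (\<forall>m<?n. (E_mat k *\<^sub>v (map_vec int u @\<^sub>v map_vec int w)) $ m = ?b $ m)"
      using dims by (auto simp del: index_mult_mat_vec intro!: eq_vecI)
    also have "\<dots> \<longleftrightarrow> (\<forall>m<?n. int (w $ m) = - ?r a m)"
    proof (intro all_cong)
      fix m assume m: "m < ?n"
      have "(E_mat k *\<^sub>v (map_vec int u @\<^sub>v map_vec int w)) $ m =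
          (\<Sum>l<?p. b_coeff k (?I ! m) (?V ! l) * int (a (?V ! l))) + int (w $ m)"
        using m u w by (subst E_mat_mult) auto
      then show "((E_mat k *\<^sub>v (map_vec int u @\<^sub>v map_vec int w)) $ m = ?b $ m) =
          (int (w $ m) = - ?r a m)"
        unfolding r[OF m] by auto
    qed
    finally show ?thesis .
  qed
  have "bij_betw f (hives k lam mu nu) sol"
  proof (rule bij_betw_imageI)
    show "inj_on f (hives k lam mu nu)"
    proof
      fix a a' assume a: "a \<in> hives k lam mu nu" "a' \<in> hives k lam mu nu" and eq: "f a = f a'"
      have "a (?V ! l) = a' (?V ! l)" if "l < ?p" for l
        using arg_cong[OF eq, of "\<lambda>x. x $ l"] that by (simp add: f_def)
      then have "a v = a' v" if "v \<in> set ?V" for v using that by (auto simp: in_set_conv_nth)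
      moreover have "a v = a' v" if "v \<notin> set ?V" for v using a that by (cases v) (simp add: hives_def)
      ultimately show "a = a'" by blast
    qed
    show "f ` hives k lam mu nu = sol"
    proof (intro equalityI subsetI)
      fix x assume "x \<in> f ` hives k lam mu nu"
      then obtain a where a: "a \<in> hives k lam mu nu" "x = f a" by blast
      then have "?r a m \<le> 0" if "m < ?n" for m using that by (simp add: hives_def)
      then show "x \<in> sol" unfolding a(2) f_def by (subst iff[OF refl]) auto
    next
      fix x assume x: "x \<in> sol"
      \<comment> \<open>Coordinates are carried back along the enumeration of the interior, which is
        injective because the list is distinct.\<close>
      define a where "a v = (if v \<in> set ?V then x $ inv_into {..<?p} ((!) ?V) v else 0)" for v
      have inj: "inj_on ((!) ?V) {..<?p}"
        using bij_betw_nth[OF distinct_interior refl refl] by (rule bij_betw_imp_inj_on)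
      have "vec_first x ?p = vec ?p (\<lambda>l. a (?V ! l))"
        by (intro eq_vecI) (auto simp: vec_first_def a_def inv_into_f_f[OF inj])
      moreover have "x = vec_first x ?p @\<^sub>v vec_last x ?n"
        using x by (intro vec_first_last_append[symmetric]) (simp add: sol_def dims)
      ultimately obtain w where x': "x = vec ?p (\<lambda>l. a (?V ! l)) @\<^sub>v w" and w: "w \<in> carrier_vec ?n"
        by (metis vec_last_carrier)
      then have w': "\<forall>m<?n. int (w $ m) = - ?r a m" using x iff[OF refl w] by simp
      then have "?r a m \<le> 0" if "m < ?n" for m using that by (metis neg_0_le_iff_le of_nat_0_le_iff)
      then have "\<forall>R\<in>set ?I. rhombus_form R (hive k (int \<circ> lam) (int \<circ> mu) (int \<circ> nu) (int \<circ> a)) \<le> 0"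
        by (metis in_set_conv_nth)
      then have "a \<in> hives k lam mu nu" by (simp add: hives_def a_def)
      moreover have "w = vec ?n (\<lambda>m. nat (- ?r a m))"
        using w w' by (intro eq_vecI) (auto simp: nat_int[symmetric] simp del: nat_int)
      then have "x = f a" using x' by (simp add: f_def)
      ultimately show "x \<in> f ` hives k lam mu nu" by blast
    qed
  qed
  then show ?thesis by (simp add: vector_partition_def sol_def bij_betw_same_card)
qed

section \<open>Hives as dominant patterns\<close>

text \<open>The right-hand side is the second family of rhombus inequalities.\<close>
lemma row_condition_iff:
  assumes d: "d \<in> gt_patterns n lam" and nu: "\<And>i. mu i + wt n d i = nu i" and "j < n"
  shows "mu (Suc i) + (\<Sum>l=j..<n. d (Suc i) l - d (Suc (Suc i)) l) \<le>
      mu i + (\<Sum>l=Suc j..<n. d i l - d (Suc i) l) \<longleftrightarrow>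
    nu (Suc i) + (\<Sum>l<j. d (Suc (Suc i)) l) + (\<Sum>l<Suc j. d i l) \<le>
      nu i + (\<Sum>l<j. d (Suc i) l) + (\<Sum>l<Suc j. d (Suc i) l)"
proof -
  note D = gt_patternsD(2)[OF d]
  have split: "(\<Sum>l<n. d i l) = (\<Sum>l<m. d i l) + (\<Sum>l=m..<n. d i l)" if "m \<le> n" for i m
    using sum.atLeastLessThan_concat[of 0 m n "d i"] that by (simp add: atLeast0LessThan)
  have tail: "(\<Sum>l=m..<n. d i l - d (Suc i) l) + (\<Sum>l=m..<n. d (Suc i) l) = (\<Sum>l=m..<n. d i l)" for i m
    using D by (simp flip: sum.distrib)
  have le: "j \<le> n" "Suc j \<le> n" using \<open>j < n\<close> by simp_all
  show ?thesis
    using wt_sum[of d i n, OF D] wt_sum[of d "Suc i" n, OF D] nu[of i] nu[of "Suc i"]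
      tail[where i = "Suc i" and m = j] tail[where i = i and m = "Suc j"]
      split[OF le(1), where i = "Suc i"] split[OF le(1), where i = "Suc (Suc i)"]
      split[OF le(2), where i = i] split[OF le(2), where i = "Suc i"]
    by - (rule iffI; linarith)
qed

text \<open>The pattern is summed up to an array: along the \<nu> side to \<open>(i, 0)\<close>,
  then along row \<open>i\<close>.\<close>

definition hive_value :: "(nat \<Rightarrow> nat) \<Rightarrow> (nat \<Rightarrow> nat \<Rightarrow> nat) \<Rightarrow> nat \<times> nat \<Rightarrow> nat" where
  "hive_value nu d = (\<lambda>(i, j). (\<Sum>t<i. nu t) + (\<Sum>l<j. d i l))"

lemma hive_value_simps:
  "hive_value nu d (i, 0) = (\<Sum>t<i. nu t)"
  "hive_value nu d (i, Suc j) = hive_value nu d (i, j) + d i j"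
  by (simp_all add: hive_value_def)

definition hive_of :: "nat \<Rightarrow> (nat \<Rightarrow> nat) \<Rightarrow> (nat \<Rightarrow> nat \<Rightarrow> nat) \<Rightarrow> nat \<times> nat \<Rightarrow> nat" where
  "hive_of k nu d = (\<lambda>v. if v \<in> set (interior k) then hive_value nu d v else 0)"

text \<open>The side \<open>i + j = k\<close> is the one with content. There all nonzero entries of
  row \<open>i\<close> have been added up; together with the weights of the rows above they give the
  size of \<open>lam\<close>, and the rest of the partial sum of \<open>nu\<close> is that of
  \<open>mu\<close>.\<close>

lemma hive_hive_of:
  assumes d: "d \<in> lr_patterns k lam mu nu" and ij: "i + j \<le> k"
  shows "hive k (int \<circ> lam) (int \<circ> mu) (int \<circ> nu) (int \<circ> hive_of k nu d) (i, j) = int (hive_value nu d (i, j))"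
proof -
  have gt: "d \<in> gt_patterns k lam" and nu: "nu = (\<lambda>i. mu i + wt k d i)"
    using d by (auto simp: lr_patterns_def)
  consider "i = 0" | "0 < i" "j = 0" | "0 < i" "0 < j" "i + j = k" | "0 < i" "0 < j" "i + j < k"
    using ij by linarith
  then show ?thesis
  proof cases
    case 3
    have "(\<Sum>l<k. d i l) = (\<Sum>l<j. d i l)"
      using 3 gt_patterns_zero[OF gt] by (intro sum.mono_neutral_right) auto
    then have "(\<Sum>t<k. lam t) + (\<Sum>t<i. mu t) = hive_value nu d (i, j)"
      using sum_wt_plus_row[OF gt, of i] by (simp add: hive_value_def nu sum.distrib)
    then have "(\<Sum>t<k. int (lam t)) + (\<Sum>t<i. int (mu t)) = int (hive_value nu d (i, j))"
      by (metis of_nat_add of_nat_sum)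
    then show ?thesis using 3 by (simp add: hive_def)
  qed (auto simp: hive_def hive_value_def hive_of_def set_interior gt_patternsD(1)[OF gt])
qed

lemma hive_of_in_hives:
  assumes d: "d \<in> lr_patterns k lam mu nu"
  shows "hive_of k nu d \<in> hives k lam mu nu"
proof -
  have gt: "d \<in> gt_patterns k lam" and dom: "dominant k mu d" and nu: "mu i + wt k d i = nu i" for i
    using d by (auto simp: lr_patterns_def)
  let ?h = "hive k (int \<circ> lam) (int \<circ> mu) (int \<circ> nu) (int \<circ> hive_of k nu d)"
  note D = gt_patternsD[OF gt]
  note [simp] = hive_hive_of[OF d]
  have "\<forall>R\<in>set (hive_inequalities k). rhombus_form R ?h \<le> 0"
    unfolding hive_inequalities_ball
  proof (intro allI impI conjI)
    fix i j assume ij: "i + j + 2 \<le> k"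
    show "rhombus_form (((i + 1, j), i, j + 1), (i, j), i + 1, j + 1) ?h \<le> 0"
      using ij D(2)[of i j] by (simp add: rhombus_form_def hive_value_simps)
    show "rhombus_form (((i, j + 1), i + 1, j + 1), (i + 1, j), i, j + 2) ?h \<le> 0"
      using ij D(3)[of i j] by (simp add: rhombus_form_def hive_value_simps)
    have "nu (Suc i) + (\<Sum>l<j. d (Suc (Suc i)) l) + (\<Sum>l<Suc j. d i l) \<le>
      nu i + (\<Sum>l<j. d (Suc i) l) + (\<Sum>l<Suc j. d (Suc i) l)"
      using row_condition_iff[OF gt nu, of j i] dominant_rows[OF gt dom, of j i] ij by simp
    then have "hive_value nu d (i + 2, j) + hive_value nu d (i, j + 1) \<le>
        hive_value nu d (i + 1, j) + hive_value nu d (i + 1, j + 1)"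
      by (simp add: hive_value_def)
    then show "rhombus_form (((i + 1, j), i + 1, j + 1), (i + 2, j), i, j + 1) ?h \<le> 0"
      using ij by (simp add: rhombus_form_def)
  qed
  then show ?thesis by (simp add: hives_def hive_of_def)
qed

lemma inj_on_hive_of: "inj_on (hive_of k nu) (lr_patterns k lam mu nu)"
proof
  fix d d' assume d: "d \<in> lr_patterns k lam mu nu" and d': "d' \<in> lr_patterns k lam mu nu"
    and eq: "hive_of k nu d = hive_of k nu d'"
  have gt: "d \<in> gt_patterns k lam" "d' \<in> gt_patterns k lam" using d d' by (auto simp: lr_patterns_def)
  have val: "hive_value nu d (i, j) = hive_value nu d' (i, j)" if "i + j \<le> k" for i j
    using hive_hive_of[OF d that] hive_hive_of[OF d' that] eq by simp
  have "d i j = d' i j" for i j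
  proof (cases "i + j < k")
    case True
    then show ?thesis using val[of i j] val[of i "Suc j"] by (simp add: hive_value_simps)
  next
    case False
    then show ?thesis using gt_patterns_zero[OF gt(1)] gt_patterns_zero[OF gt(2)] by simp
  qed
  then show "d = d'" by blast
qed

lemma hives_surj:
  assumes a: "a \<in> hives k lam mu nu"
    and zero: "\<forall>i\<ge>k. lam i = 0" "\<forall>i\<ge>k. mu i = 0" "\<forall>i\<ge>k. nu i = 0" and mu: "antimono mu"
    and size: "(\<Sum>t<k. lam t) + (\<Sum>t<k. mu t) = (\<Sum>t<k. nu t)"
  obtains d where "d \<in> lr_patterns k lam mu nu" "hive_of k nu d = a"
proof -
  define h where "h = hive k (int \<circ> lam) (int \<circ> mu) (int \<circ> nu) (int \<circ> a)"
  define e where "e i j = h (i, Suc j) - h (i, j)" for i j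
  define d where "d i j = (if i + j < k then nat (e i j) else 0)" for i j
  have "\<forall>R\<in>set (hive_inequalities k). rhombus_form R h \<le> 0"
    using a by (simp add: hives_def h_def)
  note ineq = this[unfolded hive_inequalities_ball]
  have ineq1: "e (Suc i) j \<le> e i j" if "i + j + 2 \<le> k" for i j
    using ineq that by (fastforce simp: rhombus_form_def e_def)
  have ineq3: "e i (Suc j) \<le> e (Suc i) j" if "i + j + 2 \<le> k" for i j
    using ineq that by (fastforce simp: rhombus_form_def e_def)
  have ineq2: "h (i + 2, j) + h (i, j + 1) \<le> h (i + 1, j) + h (i + 1, j + 1)" if "i + j + 2 \<le> k" for i j
    using ineq that by (fastforce simp: rhombus_form_def)
  have e0: "e 0 j = int (lam j)" for j by (simp add: e_def h_def hive_def)
  \<comment> \<open>The differences of a hive are integers; iterating the third family back to row 0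
    bounds them below by parts of \<open>lam\<close>, so \<open>nat\<close> in \<open>d\<close>
    loses nothing.\<close>
  have "int (lam (i + j)) \<le> e i j" if "i + j < k" for i j
    using that
  proof (induction i arbitrary: j)
    case (Suc i)
    then show ?case using Suc.IH[of "Suc j"] ineq3[of i j] by simp
  qed (simp add: e0)
  then have de: "int (d i j) = e i j" if "i + j < k" for i j
    using that by (simp add: d_def) (meson of_nat_0_le_iff order_trans)
  have d_zero: "d i j = 0" if "k \<le> i + j" for i j using that by (simp add: d_def)
  have gt: "d \<in> gt_patterns k lam"
  proof -
    have "d 0 l = lam l" for l using e0 zero(1) by (simp add: d_def)
    moreover have "d (Suc i) l \<le> d i l" for i l
      using ineq1[of i l] de[of i l] de[of "Suc i" l] d_zero[of "Suc i" l]
      by (cases "i + l + 2 \<le> k") auto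
    moreover have "d i (Suc l) \<le> d (Suc i) l" for i l
      using ineq3[of i l] de[of i "Suc l"] de[of "Suc i" l] d_zero[of i "Suc l"]
      by (cases "i + l + 2 \<le> k") auto
    ultimately show ?thesis by (auto simp: gt_patterns_def d_zero)
  qed
  have h: "h (i, j) = int (hive_value nu d (i, j))" if "i + j \<le> k" for i j
    using that
  proof (induction j)
    case 0
    then show ?case by (simp add: hive_value_simps) (simp add: h_def hive_def)
  next
    case (Suc j)
    then show ?case using de[of i j] by (simp add: hive_value_simps e_def)
  qed
  have total: "(\<Sum>t<i. nu t) + (\<Sum>l<k. d i l) = (\<Sum>t<k. lam t) + (\<Sum>t<i. mu t)" if ik: "i \<le> k" for i
  proof -
    have "(\<Sum>l<k. d i l) = (\<Sum>l<k - i. d i l)"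
      by (rule sum.mono_neutral_right) (auto simp: d_zero)
    moreover have "h (i, k - i) = int ((\<Sum>t<k. lam t) + (\<Sum>t<i. mu t))"
    proof -
      consider "i = 0" | "0 < i" "i = k" | "0 < i" "i < k" using ik by linarith
      then show ?thesis
      proof cases
        case 2
        \<comment> \<open>At the corner \<open>(k, 0)\<close> the array holds the sum of
          \<open>nu\<close>; the size condition turns it into the value required by the other
          side.\<close>
        then show ?thesis using arg_cong[OF size, of int] by (simp add: h_def hive_def)
      qed (simp_all add: h_def hive_def)
    qed
    ultimately have "int (hive_value nu d (i, k - i)) = int ((\<Sum>t<k. lam t) + (\<Sum>t<i. mu t))"
      using h[of i "k - i"] ik by simp
    then show ?thesis
      unfolding of_nat_eq_iff by (simp add: hive_value_def \<open>(\<Sum>l<k. d i l) = (\<Sum>l<k - i. d i l)\<close>)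
  qed
  have nu: "mu i + wt k d i = nu i" for i
  proof (cases "i < k")
    case True
    then show ?thesis
      using total[of i] total[of "Suc i"] wt_sum[of d i k] gt_patternsD(2)[OF gt] by simp
  next
    case False
    then show ?thesis using zero d_zero by (simp add: wt_def)
  qed
  have "dominant k mu d"
  proof (rule rows_dominant[OF gt mu])
    fix i j assume "j < k"
    show "mu (Suc i) + (\<Sum>l=j..<k. d (Suc i) l - d (Suc (Suc i)) l) \<le>
        mu i + (\<Sum>l=Suc j..<k. d i l - d (Suc i) l)"
    proof (cases "i + j + 2 \<le> k")
      case True
      have "hive_value nu d (i + 2, j) + hive_value nu d (i, j + 1) \<le>
          hive_value nu d (i + 1, j) + hive_value nu d (i + 1, j + 1)"
        using ineq2[OF True] True by (simp add: h flip: of_nat_add)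
      then show ?thesis
        unfolding row_condition_iff[OF gt nu \<open>j < k\<close>] by (simp add: hive_value_def)
    next
      case False
      \<comment> \<open>No rhombus exists here, but row \<open>Suc i\<close> vanishes from position
        \<open>j\<close> on, and what remains follows from \<open>mu\<close> being
        decreasing.\<close>
      then have "(\<Sum>l=j..<k. d (Suc i) l - d (Suc (Suc i)) l) = 0" by (simp add: d_zero)
      then show ?thesis using antimonoD[OF mu, of i "Suc i"] by simp
    qed
  qed
  then have "d \<in> lr_patterns k lam mu nu" using gt nu by (simp add: lr_patterns_def)
  moreover have "hive_of k nu d = a"
  proof
    fix v
    show "hive_of k nu d v = a v"
    proof (cases "v \<in> set (interior k)")
      case True
      then obtain i j where v: "v = (i, j)" "0 < i" "0 < j" "i + j < k" by (auto simp: set_interior)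
      then have "int (a v) = h v" by (simp add: h_def hive_def)
      then show ?thesis using h[of i j] v True by (simp add: hive_of_def)
    next
      case False
      then show ?thesis using a by (cases v) (simp add: hive_of_def hives_def)
    qed
  qed
  ultimately show thesis using that by blast
qed

lemma partition_size_eq_sum:
  assumes "at_most_parts k lam"
  shows "partition_size lam = (\<Sum>i<k. lam i)"
  unfolding partition_size_def
  using assms by (intro sum.mono_neutral_left) (auto simp: at_most_parts_def intro: ccontr)

theorem theorem2p1:
  fixes k :: nat and lam mu nu :: "nat \<Rightarrow> nat"
  assumes "k \<ge> 1"
    and "is_partition lam" "is_partition mu" "is_partition nu"
    and "at_most_parts k lam" "at_most_parts k mu" "at_most_parts k nu"
    and "partition_size lam + partition_size mu = partition_size nu"
    and "\<forall>i. lam i \<le> nu i" and "\<forall>i. mu i \<le> nu i"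
  shows "lr_coeff lam mu nu =
    int (vector_partition (E_mat k)
      (B_mat k *\<^sub>v (part_vec k lam @\<^sub>v part_vec k mu @\<^sub>v part_vec k nu)))"
proof -
  have zero: "\<forall>i\<ge>k. lam i = 0" "\<forall>i\<ge>k. mu i = 0" "\<forall>i\<ge>k. nu i = 0"
    using assms(5-7) by (simp_all add: at_most_parts_def)
  have mu: "antimono mu" using assms(3) by (simp add: is_partition_def)
  have size: "(\<Sum>t<k. lam t) + (\<Sum>t<k. mu t) = (\<Sum>t<k. nu t)"
    using assms(8) unfolding assms(5-7)[THEN partition_size_eq_sum] .
  have "hive_of k nu ` lr_patterns k lam mu nu = hives k lam mu nu"
    using hive_of_in_hives hives_surj[OF _ zero mu size] by blast
  then have "bij_betw (hive_of k nu) (lr_patterns k lam mu nu) (hives k lam mu nu)"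
    by (rule bij_betw_imageI[OF inj_on_hive_of])
  then have "card (lr_patterns k lam mu nu) = card (hives k lam mu nu)"
    by (rule bij_betw_same_card)
  then show ?thesis
    using lr_coeff_eq_card[OF assms(2,3) zero(3)]
    by (simp add: vector_partition_eq_card_hives)
qed

end
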